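(* Let $M$ be a convex $\omega$-complete effect monoid. Then $M\cong[0,1]_{C(X)}$ for some basically disconnected Hausdorff space $X$. If $M$ is even directed complete, then $X$ is extremally disconnected.
   Context: An effect algebra is a set $E$ with an element $0$, a partial binary operation $a+b$ (the partial sum), and a total complement $a\mapsto a^\perp$, such that: the sum is commutative and associative wherever defined, $a+0=a$, $a^\perp$ is the unique element with $a+a^\perp=1$ where $1:=0^\perp$, and $a+1$ defined implies $a=0$. The order is $a\le b$ iff $b=a+c$ for some $c$. An effect monoid is an effect algebra with an associative total multiplication $\cdot$ with unit $1$ which distributes over the partial sum on both sides. It is $\omega$-complete if every increasing sequence has a supremum, directed complete if every directed subset has a supremum. An effect algebra $E$ is convex if there is an action $[0,1]\times E\to E$, $(\lambda,a)\mapsto\lambda a$, with $\lambda(\mu a)=(\lambda\mu)a$; if $\lambda+\mu\le1$ then $\lambda a+\mu a$ is defined and equals $(\lambda+\mu)a$; if $a+b$ is defined then $\lambda a+\lambda b$ is defined and equals $\lambda(a+b)$; and $1a=a$. $[0,1]_{C(X)}$ is the set of continuous functions $X\to[0,1]$ on a compact Hausdorff space $X$, with $f+g$ defined iff $f+g\le 1$, complement $1-f$, pointwise multiplication. Basically disconnected: every cozero set has open closure; extremally disconnected: closure of every open set is open. *)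

theory Defs
  imports "HOL-Analysis.Analysis"
begin

text \<open>The partial sum \<open>osum\<close> is option-valued: \<open>None\<close> means undefined.\<close>

record 'a effect_algebra =
  ecarrier :: "'a set"
  ezero :: 'a
  osum :: "'a \<Rightarrow> 'a \<Rightarrow> 'a option"
  ecompl :: "'a \<Rightarrow> 'a"

record 'a effect_monoid = "'a effect_algebra" +
  emult :: "'a \<Rightarrow> 'a \<Rightarrow> 'a"

definition eone :: "('a, 'b) effect_algebra_scheme \<Rightarrow> 'a" where
  "eone E = ecompl E (ezero E)"

locale effect_algebra =
  fixes E :: "('a, 'b) effect_algebra_scheme"
  assumes zero_closed: "ezero E \<in> ecarrier E"
    and compl_closed: "a \<in> ecarrier E \<Longrightarrow> ecompl E a \<in> ecarrier E"
    and osum_closed: "\<lbrakk>a \<in> ecarrier E; b \<in> ecarrier E; osum E a b = Some c\<rbrakk> \<Longrightarrow> c \<in> ecarrier E"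
    and osum_comm: "\<lbrakk>a \<in> ecarrier E; b \<in> ecarrier E\<rbrakk> \<Longrightarrow> osum E a b = osum E b a"
    and osum_assoc: "\<lbrakk>a \<in> ecarrier E; b \<in> ecarrier E; c \<in> ecarrier E;
        osum E a b = Some d; osum E d c = Some e\<rbrakk>
        \<Longrightarrow> \<exists>f. osum E b c = Some f \<and> osum E a f = Some e"
    and osum_zero: "a \<in> ecarrier E \<Longrightarrow> osum E a (ezero E) = Some a"
    and osum_compl: "a \<in> ecarrier E \<Longrightarrow> osum E a (ecompl E a) = Some (eone E)"
    and compl_unique: "\<lbrakk>a \<in> ecarrier E; b \<in> ecarrier E; osum E a b = Some (eone E)\<rbrakk>
        \<Longrightarrow> b = ecompl E a"
    and osum_one: "\<lbrakk>a \<in> ecarrier E; osum E a (eone E) \<noteq> None\<rbrakk> \<Longrightarrow> a = ezero E"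

locale effect_monoid = effect_algebra E
  for E :: "('a, 'b) effect_monoid_scheme" +
  assumes mult_closed: "\<lbrakk>a \<in> ecarrier E; b \<in> ecarrier E\<rbrakk> \<Longrightarrow> emult E a b \<in> ecarrier E"
    and mult_assoc: "\<lbrakk>a \<in> ecarrier E; b \<in> ecarrier E; c \<in> ecarrier E\<rbrakk>
        \<Longrightarrow> emult E (emult E a b) c = emult E a (emult E b c)"
    and mult_one_left: "a \<in> ecarrier E \<Longrightarrow> emult E (eone E) a = a"
    and mult_one_right: "a \<in> ecarrier E \<Longrightarrow> emult E a (eone E) = a"
    and distrib_left: "\<lbrakk>a \<in> ecarrier E; b \<in> ecarrier E; c \<in> ecarrier E; osum E b c = Some d\<rbrakk>
        \<Longrightarrow> osum E (emult E a b) (emult E a c) = Some (emult E a d)"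
    and distrib_right: "\<lbrakk>a \<in> ecarrier E; b \<in> ecarrier E; c \<in> ecarrier E; osum E b c = Some d\<rbrakk>
        \<Longrightarrow> osum E (emult E b a) (emult E c a) = Some (emult E d a)"

definition ele :: "('a, 'b) effect_algebra_scheme \<Rightarrow> 'a \<Rightarrow> 'a \<Rightarrow> bool" where
  "ele E a b \<longleftrightarrow> (\<exists>c\<in>ecarrier E. osum E a c = Some b)"

definition is_esup :: "('a, 'b) effect_algebra_scheme \<Rightarrow> 'a set \<Rightarrow> 'a \<Rightarrow> bool" where
  "is_esup E A s \<longleftrightarrow> s \<in> ecarrier E \<and> (\<forall>a\<in>A. ele E a s) \<and>
     (\<forall>u\<in>ecarrier E. (\<forall>a\<in>A. ele E a u) \<longrightarrow> ele E s u)"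

definition omega_complete :: "('a, 'b) effect_algebra_scheme \<Rightarrow> bool" where
  "omega_complete E \<longleftrightarrow>
     (\<forall>a :: nat \<Rightarrow> 'a. (\<forall>n. a n \<in> ecarrier E) \<and> (\<forall>n. ele E (a n) (a (Suc n)))
        \<longrightarrow> (\<exists>s. is_esup E (range a) s))"

definition directed_in :: "('a, 'b) effect_algebra_scheme \<Rightarrow> 'a set \<Rightarrow> bool" where
  "directed_in E A \<longleftrightarrow> A \<subseteq> ecarrier E \<and> A \<noteq> {} \<and>
     (\<forall>a\<in>A. \<forall>b\<in>A. \<exists>c\<in>A. ele E a c \<and> ele E b c)"

definition directed_complete :: "('a, 'b) effect_algebra_scheme \<Rightarrow> bool" where
  "directed_complete E \<longleftrightarrow> (\<forall>A. directed_in E A \<longrightarrow> (\<exists>s. is_esup E A s))"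

definition convex_action ::
    "('a, 'b) effect_algebra_scheme \<Rightarrow> (real \<Rightarrow> 'a \<Rightarrow> 'a) \<Rightarrow> bool" where
  "convex_action E act \<longleftrightarrow>
     (\<forall>l\<in>{0..1}. \<forall>a\<in>ecarrier E. act l a \<in> ecarrier E) \<and>
     (\<forall>l\<in>{0..1}. \<forall>m\<in>{0..1}. \<forall>a\<in>ecarrier E. act l (act m a) = act (l * m) a) \<and>
     (\<forall>l\<in>{0..1}. \<forall>m\<in>{0..1}. \<forall>a\<in>ecarrier E. l + m \<le> 1
        \<longrightarrow> osum E (act l a) (act m a) = Some (act (l + m) a)) \<and>
     (\<forall>l\<in>{0..1}. \<forall>a\<in>ecarrier E. \<forall>b\<in>ecarrier E. \<forall>c. osum E a b = Some c
        \<longrightarrow> osum E (act l a) (act l b) = Some (act l c)) \<and>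
     (\<forall>a\<in>ecarrier E. act 1 a = a)"

definition convex_effect_algebra :: "('a, 'b) effect_algebra_scheme \<Rightarrow> bool" where
  "convex_effect_algebra E \<longleftrightarrow> effect_algebra E \<and> (\<exists>act. convex_action E act)"

definition effect_monoid_hom ::
    "('a, 'c) effect_monoid_scheme \<Rightarrow> ('b, 'd) effect_monoid_scheme \<Rightarrow> ('a \<Rightarrow> 'b) \<Rightarrow> bool" where
  "effect_monoid_hom E F h \<longleftrightarrow>
     h \<in> ecarrier E \<rightarrow> ecarrier F \<and>
     h (eone E) = eone F \<and>
     (\<forall>a\<in>ecarrier E. \<forall>b\<in>ecarrier E. \<forall>c. osum E a b = Some c
        \<longrightarrow> osum F (h a) (h b) = Some (h c)) \<and>
     (\<forall>a\<in>ecarrier E. \<forall>b\<in>ecarrier E. h (emult E a b) = emult F (h a) (h b))"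

text \<open>The inverse is required to be a morphism as well, because a bijective morphism need not
  reflect definedness of sums.\<close>

definition effect_monoid_isomorphic ::
    "('a, 'c) effect_monoid_scheme \<Rightarrow> ('b, 'd) effect_monoid_scheme \<Rightarrow> bool" where
  "effect_monoid_isomorphic E F \<longleftrightarrow>
     (\<exists>h. bij_betw h (ecarrier E) (ecarrier F) \<and> effect_monoid_hom E F h \<and>
          effect_monoid_hom F E (inv_into (ecarrier E) h))"

text \<open>The effect monoid $[0,1]_{C(X)}$. Its elements are restricted to \<open>topspace X\<close>
  (undefined outside), so that equality in HOL is equality as functions on the space.\<close>

definition unit_interval_C :: "'x topology \<Rightarrow> ('x \<Rightarrow> real) effect_monoid" where
  "unit_interval_C X = \<lparr>
     ecarrier = {f \<in> extensional (topspace X). continuous_map X (top_of_set {0..1}) f},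
     ezero = (\<lambda>x\<in>topspace X. 0),
     osum = (\<lambda>f g. if \<forall>x\<in>topspace X. f x + g x \<le> 1
                    then Some (\<lambda>x\<in>topspace X. f x + g x) else None),
     ecompl = (\<lambda>f. \<lambda>x\<in>topspace X. 1 - f x),
     emult = (\<lambda>f g. \<lambda>x\<in>topspace X. f x * g x)\<rparr>"

definition cozero_set_in :: "'x topology \<Rightarrow> 'x set \<Rightarrow> bool" where
  "cozero_set_in X U \<longleftrightarrow>
     (\<exists>f. continuous_map X euclideanreal f \<and> U = {x \<in> topspace X. f x \<noteq> 0})"

definition basically_disconnected :: "'x topology \<Rightarrow> bool" where
  "basically_disconnected X \<longleftrightarrow> (\<forall>U. cozero_set_in X U \<longrightarrow> openin X (X closure_of U))"

definition extremally_disconnected :: "'x topology \<Rightarrow> bool" where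
  "extremally_disconnected X \<longleftrightarrow> (\<forall>U. openin X U \<longrightarrow> openin X (X closure_of U))"

end

theory Submission
  imports Defs "HOL-Real_Asymp.Real_Asymp"
begin

text \<open>The isomorphism is the Gelfand map into the continuous functions on the compact space of
  characters, that is, of multiplicative states \<open>M \<rightarrow> [0,1]\<close>. The point is to find enough characters
  without assuming commutativity. Think of \<open>M\<close> as the unit interval of an ordered algebra with
  positive cone \<open>P\<close>, and let \<open>Q \<supseteq> P\<close> be a convex cone with \<open>P Q \<subseteq> Q\<close> and \<open>-1 \<notin> Q\<close>. For
  \<open>s = inf {r. r - a \<in> Q}\<close> the cone \<open>Q + P (a - s)\<close> still omits \<open>-1\<close>: if \<open>-1 = q + c (a - s)\<close> with
  \<open>0 \<le> c \<le> k\<close>, then adding \<open>(k - c) (s - a)\<close>, which is in \<open>Q\<close> up to an arbitrarily small error, gives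
  \<open>s - 1/k - a \<in> Q\<close> up to that error, against the choice of \<open>s\<close>. So if \<open>Q\<close> is maximal, then
  \<open>a \<mapsto> s\<close> is a character, and a first extension step applied to \<open>Q = P\<close> yields a character attaining
  \<open>inf {r. a \<le> r}\<close>. With \<open>\<omega>\<close>-completeness (which makes \<open>M\<close> Archimedean) characters therefore
  determine the order. Stone--Weierstrass and a second use of \<open>\<omega>\<close>-completeness give surjectivity.
  Finally, the supremum of a family of functions that are supported in an open set \<open>U\<close> and reach the
  value 1 at each point of \<open>U\<close> is the indicator of the closure of \<open>U\<close>, which is hence open.\<close>

section \<open>Order and finite sums in effect algebras\<close>

context effect_algebra
begin

abbreviation C :: "'a set" where "C \<equiv> ecarrier E"
abbreviation zer :: "'a" ("\<zero>") where "\<zero> \<equiv> ezero E"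
abbreviation one :: "'a" ("\<one>") where "\<one> \<equiv> eone E"
abbreviation leq :: "'a \<Rightarrow> 'a \<Rightarrow> bool" (infix "\<sqsubseteq>" 50) where "a \<sqsubseteq> b \<equiv> ele E a b"

lemma one_closed: "\<one> \<in> C"
  unfolding eone_def by (intro compl_closed zero_closed)

lemma osum_zero_left: "a \<in> C \<Longrightarrow> osum E \<zero> a = Some a"
  using osum_comm osum_zero zero_closed by force

lemma compl_compl: "a \<in> C \<Longrightarrow> ecompl E (ecompl E a) = a"
  by (metis compl_closed compl_unique osum_comm osum_compl)

text \<open>If \<open>a\<close> and \<open>x\<close> sum to \<open>c\<close>, associativity regroups
  the sum of \<open>x\<close>, \<open>a\<close> and the complement of \<open>c\<close>, which is 1.
  So \<open>x\<close> is the complement of an element depending only on \<open>a\<close> and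
  \<open>c\<close>.\<close>

lemma osum_cancel:
  assumes "a \<in> C" "b \<in> C" "b' \<in> C" "osum E a b = Some c" "osum E a b' = Some c"
  shows "b = b'"
proof -
  have c: "c \<in> C" using assms osum_closed by blast
  have *: "\<exists>f. osum E a (ecompl E c) = Some f \<and> x = ecompl E f"
    if x: "x \<in> C" "osum E a x = Some c" for x
  proof -
    have "osum E x a = Some c" using x assms osum_comm by metis
    then obtain f where f: "osum E a (ecompl E c) = Some f" "osum E x f = Some \<one>"
      using osum_assoc[OF x(1) assms(1) compl_closed[OF c] _ osum_compl[OF c]] by blast
    have fC: "f \<in> C" using f assms c compl_closed osum_closed by blast
    then show ?thesis using f x compl_unique osum_comm by metis
  qed
  show ?thesis using *[OF assms(2,4)] *[OF assms(3,5)] by auto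
qed

text \<open>Since \<open>0 + 1\<close> is defined, so is \<open>(a + b) + 1\<close>; associativity
  makes \<open>b + 1\<close> defined, which forces \<open>b\<close> to vanish.\<close>

lemma osum_zero_imp_zero:
  assumes "a \<in> C" "b \<in> C" "osum E a b = Some \<zero>" shows "b = \<zero>"
proof -
  have "osum E \<zero> \<one> = Some \<one>" by (simp add: osum_zero_left one_closed)
  then have "osum E b \<one> \<noteq> None" using osum_assoc[OF assms(1,2) one_closed assms(3)] by auto
  then show ?thesis using osum_one assms by blast
qed

lemma leq_closed: "a \<in> C \<Longrightarrow> a \<sqsubseteq> b \<Longrightarrow> b \<in> C"
  unfolding ele_def using osum_closed by blast

lemma leq_refl: "a \<in> C \<Longrightarrow> a \<sqsubseteq> a"
  unfolding ele_def using zero_closed osum_zero by blast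

lemma leq_zero: "a \<in> C \<Longrightarrow> \<zero> \<sqsubseteq> a"
  unfolding ele_def using osum_zero_left by blast

lemma leq_one: "a \<in> C \<Longrightarrow> a \<sqsubseteq> \<one>"
  unfolding ele_def using osum_compl compl_closed by blast

lemma leq_osum: "a \<in> C \<Longrightarrow> b \<in> C \<Longrightarrow> osum E a b = Some c \<Longrightarrow> a \<sqsubseteq> c"
  unfolding ele_def by blast

lemma leq_trans: "a \<in> C \<Longrightarrow> a \<sqsubseteq> b \<Longrightarrow> b \<sqsubseteq> c \<Longrightarrow> a \<sqsubseteq> c"
  unfolding ele_def by (meson osum_assoc osum_closed)

text \<open>The two differences satisfy \<open>a + (x + y) = a\<close>; cancellation gives
  \<open>x + y = 0\<close>, hence \<open>y = 0\<close>.\<close>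

lemma leq_antisym:
  assumes "a \<in> C" "a \<sqsubseteq> b" "b \<sqsubseteq> a" shows "a = b"
proof -
  obtain x y where x: "x \<in> C" "osum E a x = Some b" and y: "y \<in> C" "osum E b y = Some a"
    using assms unfolding ele_def by blast
  obtain f where f: "osum E x y = Some f" "osum E a f = Some a"
    using osum_assoc[OF assms(1) x(1) y(1) x(2) y(2)] by blast
  have "f = \<zero>" using osum_cancel[OF assms(1) _ zero_closed f(2) osum_zero[OF assms(1)]] f x y osum_closed by blast
  then have "y = \<zero>" using osum_zero_imp_zero f x y by blast
  then show ?thesis using y x assms osum_closed osum_zero by (metis option.inject)
qed

text \<open>A total version of the sum, with \<open>None\<close> absorbing and membership tested
  inside. Commutativity and associativity then hold without side conditions, so finite sums can be
  folds over multisets.\<close>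

definition oadd :: "'a option \<Rightarrow> 'a option \<Rightarrow> 'a option" where
  "oadd x y = (case x of None \<Rightarrow> None | Some a \<Rightarrow> (case y of None \<Rightarrow> None
     | Some b \<Rightarrow> if a \<in> C \<and> b \<in> C then osum E a b else None))"

lemma oadd_Some [simp]: "a \<in> C \<Longrightarrow> b \<in> C \<Longrightarrow> oadd (Some a) (Some b) = osum E a b"
  by (simp add: oadd_def)

lemma oadd_None [simp]: "oadd None y = None" "oadd x None = None"
  by (auto simp: oadd_def split: option.splits)

lemma oadd_eq_Some:
  "oadd x y = Some c \<longleftrightarrow> (\<exists>a\<in>C. \<exists>b\<in>C. x = Some a \<and> y = Some b \<and> osum E a b = Some c)"
  by (auto simp: oadd_def split: option.splits if_splits)

lemma oadd_closed: "oadd x y = Some c \<Longrightarrow> c \<in> C"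
  by (auto simp: oadd_eq_Some intro: osum_closed)

lemma oadd_commute: "oadd x y = oadd y x"
  by (auto simp: oadd_def osum_comm split: option.splits)

lemma oadd_assoc: "oadd (oadd x y) z = oadd x (oadd y z)"
proof -
  have *: "oadd x (oadd y z) = Some e" if e: "oadd (oadd x y) z = Some e" for x y z e
  proof -
    obtain d c where 1: "d \<in> C" "c \<in> C" "oadd x y = Some d" "z = Some c" "osum E d c = Some e"
      using e by (subst (asm) oadd_eq_Some) blast
    obtain a b where 2: "a \<in> C" "b \<in> C" "x = Some a" "y = Some b" "osum E a b = Some d"
      using 1(3) by (subst (asm) oadd_eq_Some) blast
    obtain f where f: "osum E b c = Some f" "osum E a f = Some e"
      using osum_assoc[OF 2(1,2) 1(2) 2(5) 1(5)] by blast
    then show ?thesis using 1 2 osum_closed[OF 2(2) 1(2) f(1)] by simp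
  qed
  \<comment> \<open>The axiom regroups in one direction only. The other direction is
    \<open>*\<close> for the sum read from right to left.\<close>
  have **: "oadd (oadd x y) z = Some e" if "oadd x (oadd y z) = Some e" for e
  proof -
    have "oadd (oadd z y) x = oadd x (oadd y z)" by (metis oadd_commute)
    with that have "oadd z (oadd y x) = Some e" using *[of z y x e] by simp
    moreover have "oadd z (oadd y x) = oadd (oadd x y) z" by (metis oadd_commute)
    ultimately show ?thesis by simp
  qed
  show ?thesis
    using *[of x y z] **  by (cases "oadd (oadd x y) z"; cases "oadd x (oadd y z)") auto
qed

lemma oadd_left_commute: "oadd x (oadd y z) = oadd y (oadd x z)"
  using oadd_assoc[of x y z] oadd_assoc[of y x z] oadd_commute[of x y] by simp

lemmas oadd_ac = oadd_assoc oadd_commute oadd_left_commute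

definition msum :: "'a multiset \<Rightarrow> 'a option" where
  "msum X = fold_mset (\<lambda>x. oadd (Some x)) (Some \<zero>) X"

lemma msum_empty [simp]: "msum {#} = Some \<zero>"
  by (simp add: msum_def)

lemma msum_add_mset: "msum (add_mset x X) = oadd (Some x) (msum X)"
proof -
  interpret comp_fun_commute "\<lambda>x. oadd (Some x)"
    by standard (auto simp: fun_eq_iff oadd_left_commute)
  show ?thesis by (simp add: msum_def)
qed

lemma msum_closed: "msum X = Some a \<Longrightarrow> a \<in> C"
  by (cases X) (auto simp: msum_add_mset zero_closed intro: oadd_closed)

lemma oadd_zero_left: "oadd (Some \<zero>) (msum X) = msum X"
  using msum_closed by (cases "msum X") (auto simp: zero_closed osum_zero_left)

lemma msum_union: "msum (X + Y) = oadd (msum X) (msum Y)"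
  by (induction X) (auto simp: msum_add_mset oadd_zero_left oadd_assoc)

lemma msum_single: "a \<in> C \<Longrightarrow> msum {#a#} = Some a"
  by (simp add: msum_add_mset zero_closed osum_zero)

text \<open>Regroup \<open>(a + x) + (b + y)\<close> as \<open>(a + b) + (x + y)\<close>. In
  particular definedness of a sum passes to smaller summands.\<close>

lemma leq_osum_mono:
  assumes C: "a \<in> C" "b \<in> C" and le: "a \<sqsubseteq> a'" "b \<sqsubseteq> b'" and s: "osum E a' b' = Some c'"
  obtains c where "osum E a b = Some c" "c \<sqsubseteq> c'"
proof -
  obtain x y where x: "x \<in> C" "osum E a x = Some a'" and y: "y \<in> C" "osum E b y = Some b'"
    using le unfolding ele_def by blast
  have C': "a' \<in> C" "b' \<in> C" using C le leq_closed by blast+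
  have "Some c' = oadd (oadd (Some a) (Some x)) (oadd (Some b) (Some y))"
    using C C' x y s by simp
  also have "\<dots> = oadd (oadd (Some a) (Some b)) (oadd (Some x) (Some y))"
    by (simp only: oadd_ac)
  finally have "oadd (oadd (Some a) (Some b)) (oadd (Some x) (Some y)) = Some c'" by (rule sym)
  then obtain c d where "c \<in> C" "d \<in> C" "oadd (Some a) (Some b) = Some c" "osum E c d = Some c'"
    by (subst (asm) oadd_eq_Some) blast
  then show thesis using that C leq_osum by auto
qed

lemma leq_osum_cancel:
  assumes C: "a \<in> C" "b \<in> C" "z \<in> C" and s: "osum E a z = Some c" "osum E b z = Some d" "c \<sqsubseteq> d"
  shows "a \<sqsubseteq> b"
proof -
  obtain x where x: "x \<in> C" "osum E c x = Some d" using s unfolding ele_def by blast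
  have cd: "c \<in> C" "d \<in> C" using C s osum_closed by blast+
  have "Some d = oadd (oadd (Some a) (Some z)) (Some x)" using C s x cd by simp
  also have "\<dots> = oadd (Some z) (oadd (Some a) (Some x))" by (simp only: oadd_ac)
  finally have "oadd (Some z) (oadd (Some a) (Some x)) = Some d" by (rule sym)
  then obtain e where e: "e \<in> C" "osum E a x = Some e" "osum E z e = Some d"
    using C x by (subst (asm) oadd_eq_Some) auto
  have "osum E z b = Some d" using s C osum_comm by metis
  then have "e = b" using e osum_cancel C by blast
  then show ?thesis using e C x leq_osum by blast
qed

text \<open>Turns definedness of a sum into a comparison, which characters can decide. It rests on
  the complement of \<open>b\<close> plus \<open>b\<close> being the top element.\<close>

lemma leq_compl_iff:
  assumes "a \<in> C" "b \<in> C"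
  shows "a \<sqsubseteq> ecompl E b \<longleftrightarrow> (\<exists>c. osum E a b = Some c)"
proof
  assume "a \<sqsubseteq> ecompl E b"
  then show "\<exists>c. osum E a b = Some c"
    using leq_osum_mono[OF assms _ leq_refl] osum_compl osum_comm compl_closed assms by metis
next
  assume "\<exists>c. osum E a b = Some c"
  then obtain c where c: "osum E a b = Some c" by blast
  have "osum E (ecompl E b) b = Some \<one>" using osum_compl osum_comm compl_closed assms by metis
  then show "a \<sqsubseteq> ecompl E b" using leq_osum_cancel assms c compl_closed leq_one osum_closed by metis
qed

lemma leq_compl_antimono:
  assumes "a \<in> C" "b \<in> C" "a \<sqsubseteq> b" shows "ecompl E b \<sqsubseteq> ecompl E a"
  by (metis assms compl_closed compl_compl leq_compl_iff osum_comm)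

lemma msum_subset: "msum X = Some a \<Longrightarrow> set_mset X \<subseteq> C"
  by (induction X arbitrary: a) (auto simp: msum_add_mset oadd_eq_Some)

lemma additive_zero:
  assumes g: "\<And>a. a \<in> C \<Longrightarrow> g a \<in> C"
    and add: "\<And>a b c. a \<in> C \<Longrightarrow> b \<in> C \<Longrightarrow> osum E a b = Some c \<Longrightarrow> osum E (g a) (g b) = Some (g c)"
  shows "g \<zero> = \<zero>"
  using osum_cancel[OF g g zero_closed add osum_zero, OF zero_closed zero_closed zero_closed zero_closed osum_zero]
    zero_closed g by simp

lemma additive_mono:
  assumes g: "\<And>a. a \<in> C \<Longrightarrow> g a \<in> C"
    and add: "\<And>a b c. a \<in> C \<Longrightarrow> b \<in> C \<Longrightarrow> osum E a b = Some c \<Longrightarrow> osum E (g a) (g b) = Some (g c)"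
    and "a \<in> C" "a \<sqsubseteq> b"
  shows "g a \<sqsubseteq> g b"
  using assms unfolding ele_def by blast

text \<open>Used with \<open>g\<close> a scaling, a left multiplication and a right
  multiplication.\<close>

lemma msum_image:
  assumes g: "\<And>a. a \<in> C \<Longrightarrow> g a \<in> C"
    and add: "\<And>a b c. a \<in> C \<Longrightarrow> b \<in> C \<Longrightarrow> osum E a b = Some c \<Longrightarrow> osum E (g a) (g b) = Some (g c)"
    and "msum X = Some s"
  shows "msum (image_mset g X) = Some (g s)"
  using assms(3)
proof (induction X arbitrary: s)
  case empty
  have "g \<zero> = \<zero>" by (rule additive_zero[OF g add])
  then show ?case using empty by simp
next
  case (add x X)
  then obtain t where t: "x \<in> C" "t \<in> C" "msum X = Some t" "osum E x t = Some s"
    by (auto simp: msum_add_mset oadd_eq_Some)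
  show ?case using add.IH[OF t(3)] g[OF t(1)] g[OF t(2)] assms(2)[OF t(1,2,4)] by (simp add: msum_add_mset)
qed

end

section \<open>Convex effect monoids\<close>

locale convex_effect_monoid = effect_monoid E
  for E :: "('a, 'b) effect_monoid_scheme" +
  fixes act :: "real \<Rightarrow> 'a \<Rightarrow> 'a"
  assumes convex: "convex_action E act"
begin

abbreviation mlt :: "'a \<Rightarrow> 'a \<Rightarrow> 'a" (infixl "\<odot>" 70) where "a \<odot> b \<equiv> emult E a b"

lemma act_closed: "0 \<le> l \<Longrightarrow> l \<le> 1 \<Longrightarrow> a \<in> C \<Longrightarrow> act l a \<in> C"
  and act_act: "0 \<le> l \<Longrightarrow> l \<le> 1 \<Longrightarrow> 0 \<le> m \<Longrightarrow> m \<le> 1 \<Longrightarrow> a \<in> C \<Longrightarrow> act l (act m a) = act (l * m) a"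
  and act_add: "0 \<le> l \<Longrightarrow> 0 \<le> m \<Longrightarrow> l + m \<le> 1 \<Longrightarrow> a \<in> C
      \<Longrightarrow> osum E (act l a) (act m a) = Some (act (l + m) a)"
  and act_osum: "0 \<le> l \<Longrightarrow> l \<le> 1 \<Longrightarrow> a \<in> C \<Longrightarrow> b \<in> C \<Longrightarrow> osum E a b = Some c
      \<Longrightarrow> osum E (act l a) (act l b) = Some (act l c)"
  and act_one: "a \<in> C \<Longrightarrow> act 1 a = a"
  using convex unfolding convex_action_def by simp_all

lemma act_mono: "0 \<le> l \<Longrightarrow> l \<le> 1 \<Longrightarrow> a \<in> C \<Longrightarrow> a \<sqsubseteq> b \<Longrightarrow> act l a \<sqsubseteq> act l b"
  by (rule additive_mono) (auto intro: act_closed act_osum)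

lemma act_mono_scalar:
  assumes "0 \<le> l" "l \<le> m" "m \<le> 1" "a \<in> C" shows "act l a \<sqsubseteq> act m a"
  using act_add[of l "m - l" a] act_closed[of l a] act_closed[of "m - l" a] leq_osum assms by simp

lemma act_zero:
  assumes "a \<in> C" shows "act 0 a = \<zero>"
  using osum_cancel[of "act 0 a" "act 0 a" \<zero>] act_add[of 0 0 a] act_closed[of 0 a] assms
    zero_closed osum_zero by simp

lemma mult_mono_left:
  assumes "a \<in> C" "b \<in> C" "a \<sqsubseteq> b" "c \<in> C" shows "c \<odot> a \<sqsubseteq> c \<odot> b"
  by (rule additive_mono) (use assms in \<open>auto intro: mult_closed distrib_left\<close>)

lemma half_add: "a \<in> C \<Longrightarrow> osum E (act (1/2) a) (act (1/2) a) = Some a"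
  using act_add[of "1/2" "1/2" a] by (simp add: act_one)

lemma half_reflect:
  assumes "a \<in> C" "b \<in> C" "act (1/2) a \<sqsubseteq> act (1/2) b" shows "a \<sqsubseteq> b"
  using leq_osum_mono[OF _ _ assms(3) assms(3) half_add[OF assms(2)]] half_add[OF assms(1)]
    act_closed[of "1/2" a] assms by auto

lemma pow_le_1: "0 \<le> 1 / (2::real) ^ n" "1 / (2::real) ^ n \<le> 1"
  by (auto simp: field_simps)

lemma act_half_pow: "a \<in> C \<Longrightarrow> act (1/2^k) (act (1/2^n) a) = act (1/2^(n+k)) a"
  by (subst act_act) (auto simp: pow_le_1 power_add mult.commute)

lemma act_pow_reflect:
  assumes "a \<in> C" "b \<in> C" "act (1/2^n) a \<sqsubseteq> act (1/2^n) b" shows "a \<sqsubseteq> b"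
  using assms
proof (induction n arbitrary: a b)
  case 0 then show ?case by (simp add: act_one)
next
  case (Suc n)
  then have "act (1/2^n) (act (1/2) a) \<sqsubseteq> act (1/2^n) (act (1/2) b)"
    using act_half_pow[of _ n 1] by simp
  then show ?case using Suc half_reflect act_closed[of "1/2"] by simp
qed

text \<open>No compatibility of the action with multiplication is assumed. But
  \<open>x = c \<odot> act (1/2) a\<close> satisfies \<open>x + x = c \<odot> a\<close> by
  distributivity, and halving this equation returns \<open>x\<close>.\<close>

lemma mult_half:
  assumes "a \<in> C" "c \<in> C" shows "c \<odot> act (1/2) a = act (1/2) (c \<odot> a)"
proof -
  let ?x = "c \<odot> act (1/2) a"
  have x: "?x \<in> C" using assms by (simp add: mult_closed act_closed)
  have "osum E ?x ?x = Some (c \<odot> a)"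
    using distrib_left half_add assms by (simp add: act_closed)
  then have "osum E (act (1/2) ?x) (act (1/2) ?x) = Some (act (1/2) (c \<odot> a))"
    using act_osum x by simp
  then show ?thesis using half_add[OF x] by simp
qed

lemma mult_half_pow:
  assumes "a \<in> C" "c \<in> C" shows "c \<odot> act (1/2^n) a = act (1/2^n) (c \<odot> a)"
  using assms(1)
proof (induction n arbitrary: a)
  case 0 then show ?case using assms by (simp add: act_one mult_closed)
next
  case (Suc n)
  have *: "act (1/2^Suc n) x = act (1/2^n) (act (1/2) x)" if "x \<in> C" for x
    using act_half_pow[of x n 1] that by simp
  show ?case using Suc assms mult_half * by (simp add: act_closed mult_closed)
qed

text \<open>Multisets over \<open>C\<close>, preordered as follows, replace the positive cone of the ordered algebra
  generated by the effect monoid. Scaling by a small \<open>1 / 2 ^ n\<close> makes all partial sums defined.\<close>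

abbreviation dsum :: "nat \<Rightarrow> 'a multiset \<Rightarrow> 'a option" where
  "dsum n X \<equiv> msum (image_mset (act (1 / 2 ^ n)) X)"

definition fs_le :: "'a multiset \<Rightarrow> 'a multiset \<Rightarrow> bool" (infix "\<preceq>" 50) where
  "X \<preceq> Y \<longleftrightarrow> set_mset X \<subseteq> C \<and> set_mset Y \<subseteq> C \<and>
     (\<forall>\<^sub>F n in sequentially. \<exists>a b. dsum n X = Some a \<and> dsum n Y = Some b \<and> a \<sqsubseteq> b)"

section \<open>The multiset preorder: sums, cancellation, left multiplication\<close>

lemma dsum_shift:
  assumes "set_mset X \<subseteq> C" "dsum n X = Some a" shows "dsum (n + k) X = Some (act (1/2^k) a)"
proof -
  have "image_mset (act (1/2^(n+k))) X = image_mset (act (1/2^k)) (image_mset (act (1/2^n)) X)"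
    unfolding image_mset.compositionality o_def
    by (rule image_mset_cong) (use assms act_half_pow in auto)
  moreover have "msum (image_mset (act (1/2^k)) (image_mset (act (1/2^n)) X)) = Some (act (1/2^k) a)"
    using act_closed[OF pow_le_1] act_osum[OF pow_le_1] by (rule msum_image[OF _ _ assms(2)])
  ultimately show ?thesis by simp
qed

text \<open>Each \<open>act l x\<close> lies below \<open>act l 1\<close>, so the sum is dominated
  by \<open>size X\<close> copies of the latter, whose sum exists. This domination also gives
  definedness.\<close>

lemma msum_act_bound:
  fixes l :: real
  assumes "set_mset X \<subseteq> C" "0 \<le> l" "real (size X) * l \<le> 1"
  shows "\<exists>s. msum (image_mset (act l) X) = Some s \<and> s \<sqsubseteq> act (real (size X) * l) \<one>"
  using assms
proof (induction X)
  case empty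
  then show ?case by (simp add: act_zero one_closed leq_refl zero_closed)
next
  case (add x X)
  have l1: "0 \<le> real (size X) * l" using add by simp
  have "real (size (add_mset x X)) * l = l + real (size X) * l" by (simp add: algebra_simps)
  then have l2: "l + real (size X) * l \<le> 1" using add.prems by simp
  have l: "0 \<le> real (size X) * l" "real (size X) * l \<le> 1" "l \<le> 1" "l + real (size X) * l \<le> 1"
    using l1 l2 add.prems by linarith+
  then obtain s where s: "msum (image_mset (act l) X) = Some s" "s \<sqsubseteq> act (real (size X) * l) \<one>"
    using add by auto
  have C: "act l x \<in> C" "s \<in> C" using add l s msum_closed by (auto intro: act_closed)
  obtain c where "osum E (act l x) s = Some c" "c \<sqsubseteq> act (l + real (size X) * l) \<one>"
    by (rule leq_osum_mono[OF C _ s(2) act_add[of l "real (size X) * l" \<one>]])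
      (use add l one_closed in \<open>auto intro: act_mono leq_one\<close>)
  then show ?case using s C by (auto simp: msum_add_mset algebra_simps)
qed

lemma dsum_defined:
  assumes "set_mset X \<subseteq> C"
  shows "\<forall>\<^sub>F n in sequentially. \<exists>a. dsum n X = Some a"
proof -
  have "\<forall>\<^sub>F n in sequentially. size X \<le> (2::nat) ^ n"
    by (rule eventually_sequentiallyI[of "size X"]) (meson le_trans less_exp less_imp_le)
  then show ?thesis
  proof eventually_elim
    case (elim n)
    then have "real (size X) \<le> 2 ^ n" by (metis of_nat_le_iff of_nat_numeral of_nat_power)
    then show ?case using msum_act_bound[OF assms, of "1/2^n"] by auto
  qed
qed

text \<open>A single scale suffices: scaling down further preserves defined sums and the
  order.\<close>

lemma fs_leI:
  assumes X: "set_mset X \<subseteq> C" and Y: "set_mset Y \<subseteq> C"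
    and s: "dsum n X = Some a" "dsum n Y = Some b" "a \<sqsubseteq> b"
  shows "X \<preceq> Y"
proof -
  have aC: "a \<in> C" using s msum_closed by blast
  have "\<exists>a b. dsum m X = Some a \<and> dsum m Y = Some b \<and> a \<sqsubseteq> b" if "n \<le> m" for m
  proof (intro exI conjI)
    have m: "n + (m - n) = m" using that by simp
    show "dsum m X = Some (act (1/2^(m-n)) a)" using dsum_shift[OF X s(1), of "m - n"] unfolding m .
    show "dsum m Y = Some (act (1/2^(m-n)) b)" using dsum_shift[OF Y s(2), of "m - n"] unfolding m .
    show "act (1/2^(m-n)) a \<sqsubseteq> act (1/2^(m-n)) b" by (rule act_mono[OF pow_le_1 aC s(3)])
  qed
  then show ?thesis unfolding fs_le_def eventually_sequentially using X Y by (intro conjI exI[of _ n] allI impI) simp_all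
qed

lemma dsum_0:
  assumes "set_mset X \<subseteq> C" shows "dsum 0 X = msum X"
proof -
  have "image_mset (act (1/2^0)) X = image_mset (\<lambda>x. x) X"
    by (rule image_mset_cong) (use assms act_one in auto)
  then show ?thesis by simp
qed

lemma fs_le_msum:
  assumes "msum X = Some a" "msum Y = Some b" "a \<sqsubseteq> b" shows "X \<preceq> Y"
  using fs_leI[of X Y 0 a b] assms msum_subset dsum_0 by metis

lemma fs_le_trans: "X \<preceq> Y \<Longrightarrow> Y \<preceq> W \<Longrightarrow> X \<preceq> W"
  unfolding fs_le_def
proof (elim conjE, intro conjI, assumption, assumption)
  assume "\<forall>\<^sub>F n in sequentially. \<exists>a b. dsum n X = Some a \<and> dsum n Y = Some b \<and> a \<sqsubseteq> b"
    "\<forall>\<^sub>F n in sequentially. \<exists>a b. dsum n Y = Some a \<and> dsum n W = Some b \<and> a \<sqsubseteq> b"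
  then show "\<forall>\<^sub>F n in sequentially. \<exists>a b. dsum n X = Some a \<and> dsum n W = Some b \<and> a \<sqsubseteq> b"
  proof eventually_elim
    case (elim n) then show ?case using leq_trans msum_closed by (metis option.inject)
  qed
qed

lemma fs_le_add:
  assumes "X \<preceq> Y" "set_mset W \<subseteq> C" shows "X + W \<preceq> Y + W"
proof -
  have XY: "set_mset (X + W) \<subseteq> C" "set_mset (Y + W) \<subseteq> C" using assms by (auto simp: fs_le_def)
  have "\<forall>\<^sub>F n in sequentially. \<exists>a b. dsum n X = Some a \<and> dsum n Y = Some b \<and> a \<sqsubseteq> b"
    using assms by (simp add: fs_le_def)
  with dsum_defined[OF XY(2)]
  have "\<forall>\<^sub>F n in sequentially. \<exists>a b. dsum n (X + W) = Some a \<and> dsum n (Y + W) = Some b \<and> a \<sqsubseteq> b"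
  proof eventually_elim
    case (elim n)
    then obtain a b w d where d: "dsum n X = Some a" "dsum n Y = Some b" "a \<sqsubseteq> b"
      "dsum n W = Some w" "osum E b w = Some d" "dsum n (Y + W) = Some d"
      by (auto simp: msum_union oadd_eq_Some)
    have C: "a \<in> C" "w \<in> C" using d msum_closed by blast+
    obtain c where "osum E a w = Some c" "c \<sqsubseteq> d"
      using leq_osum_mono[OF C d(3) leq_refl[OF C(2)] d(5)] .
    then show ?case using d C by (auto simp: msum_union)
  qed
  then show ?thesis using XY by (simp add: fs_le_def)
qed

lemma fs_le_cancel:
  assumes "X + W \<preceq> Y + W" shows "X \<preceq> Y"
proof -
  have XY: "set_mset X \<subseteq> C" "set_mset Y \<subseteq> C" using assms by (auto simp: fs_le_def)
  have "\<forall>\<^sub>F n in sequentially. \<exists>a b. dsum n (X + W) = Some a \<and> dsum n (Y + W) = Some b \<and> a \<sqsubseteq> b"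
    using assms by (simp add: fs_le_def)
  then have "\<forall>\<^sub>F n in sequentially. \<exists>a b. dsum n X = Some a \<and> dsum n Y = Some b \<and> a \<sqsubseteq> b"
  proof eventually_elim
    case (elim n)
    then obtain a b w c d where d: "dsum n X = Some a" "dsum n Y = Some b" "dsum n W = Some w"
      "osum E a w = Some c" "osum E b w = Some d" "c \<sqsubseteq> d"
      by (auto simp: msum_union oadd_eq_Some)
    then show ?case using leq_osum_cancel msum_closed by blast
  qed
  then show ?thesis using XY by (simp add: fs_le_def)
qed

text \<open>Left multiplication is additive and monotone and commutes with scaling by powers of 1/2,
  so it can be applied to the scaled sums.\<close>

lemma fs_le_mult:
  assumes "X \<preceq> Y" "c \<in> C" shows "image_mset ((\<odot>) c) X \<preceq> image_mset ((\<odot>) c) Y"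
proof -
  have XY: "set_mset X \<subseteq> C" "set_mset Y \<subseteq> C" using assms by (auto simp: fs_le_def)
  have dc: "dsum n (image_mset ((\<odot>) c) X) = Some (c \<odot> a)"
    if "dsum n X = Some a" "set_mset X \<subseteq> C" for n X a
  proof -
    have "image_mset (act (1/2^n)) (image_mset ((\<odot>) c) X) = image_mset ((\<odot>) c) (image_mset (act (1/2^n)) X)"
      unfolding image_mset.compositionality o_def
      by (rule image_mset_cong) (use that assms mult_half_pow in auto)
    moreover have "msum (image_mset ((\<odot>) c) (image_mset (act (1/2^n)) X)) = Some (c \<odot> a)"
      by (rule msum_image[OF _ _ that(1)]) (use assms mult_closed distrib_left in blast)+
    ultimately show ?thesis by simp
  qed
  have "\<forall>\<^sub>F n in sequentially. \<exists>a b. dsum n X = Some a \<and> dsum n Y = Some b \<and> a \<sqsubseteq> b"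
    using assms by (simp add: fs_le_def)
  then have "\<forall>\<^sub>F n in sequentially. \<exists>a b. dsum n (image_mset ((\<odot>) c) X) = Some a \<and>
      dsum n (image_mset ((\<odot>) c) Y) = Some b \<and> a \<sqsubseteq> b"
  proof eventually_elim
    case (elim n)
    then obtain a b where d: "dsum n X = Some a" "dsum n Y = Some b" "a \<sqsubseteq> b" by blast
    then have "c \<odot> a \<sqsubseteq> c \<odot> b" using mult_mono_left assms msum_closed by blast
    then show ?case using dc d XY by blast
  qed
  then show ?thesis using XY assms mult_closed by (auto simp: fs_le_def)
qed

text \<open>Nothing is lost by passing to multisets: scaling by a power of 1/2 reflects the
  order.\<close>

lemma fs_le_single:
  assumes "{#a#} \<preceq> {#b#}" shows "a \<sqsubseteq> b"
proof -
  have C: "a \<in> C" "b \<in> C" using assms by (auto simp: fs_le_def)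
  have "\<forall>\<^sub>F n in sequentially. \<exists>x y. dsum n {#a#} = Some x \<and> dsum n {#b#} = Some y \<and> x \<sqsubseteq> y"
    using assms by (simp add: fs_le_def)
  then obtain n where "act (1/2^n) a \<sqsubseteq> act (1/2^n) b"
    using C pow_le_1 act_closed by (auto simp: msum_single eventually_sequentially)
  then show ?thesis using act_pow_reflect C by blast
qed

lemma fs_le_empty: "{#a#} \<preceq> {#} \<Longrightarrow> a = \<zero>"
proof -
  assume a: "{#a#} \<preceq> {#}"
  then have "a \<in> C" by (simp add: fs_le_def)
  moreover have "{#} \<preceq> {#\<zero>#}"
    using fs_le_msum[of "{#}" \<zero> "{#\<zero>#}" \<zero>] by (simp add: msum_single zero_closed leq_refl)
  ultimately show ?thesis using a fs_le_trans fs_le_single leq_antisym leq_zero by metis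
qed

section \<open>Scalar multiples of the unit\<close>

abbreviation sc :: "real \<Rightarrow> 'a" where "sc r \<equiv> act r \<one>"

lemma sc_closed: "0 \<le> r \<Longrightarrow> r \<le> 1 \<Longrightarrow> sc r \<in> C"
  by (intro act_closed one_closed)

lemma sc_add: "0 \<le> r \<Longrightarrow> 0 \<le> t \<Longrightarrow> r + t \<le> 1 \<Longrightarrow> osum E (sc r) (sc t) = Some (sc (r + t))"
  by (intro act_add one_closed)

lemma sc_mono: "0 \<le> r \<Longrightarrow> r \<le> t \<Longrightarrow> t \<le> 1 \<Longrightarrow> sc r \<sqsubseteq> sc t"
  by (intro act_mono_scalar one_closed)

lemma sc_1: "sc 1 = \<one>"
  by (intro act_one one_closed)

lemma fs_le_refl: "set_mset X \<subseteq> C \<Longrightarrow> X \<preceq> X"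
  using fs_le_add[of "{#}" "{#}" X] fs_le_msum[of "{#}" \<zero> "{#}" \<zero>] by (simp add: leq_refl zero_closed)

lemma fs_le_zero: assumes "set_mset X \<subseteq> C" shows "{#} \<preceq> X"
  using assms
proof (induction X)
  case empty
  then show ?case by (simp add: fs_le_refl)
next
  case (add x X)
  have "{#} \<preceq> {#x#}"
    using fs_le_msum[of "{#}" \<zero> "{#x#}" x] add by (simp add: msum_single leq_zero)
  then have "{#} + X \<preceq> {#x#} + X" using add by (intro fs_le_add) auto
  then show ?case using add fs_le_trans by auto
qed

lemma msum_pair: "a \<in> C \<Longrightarrow> b \<in> C \<Longrightarrow> msum {#a, b#} = osum E a b"
  by (simp add: msum_add_mset zero_closed osum_zero)

lemma msum_replicate_sc:
  assumes "0 \<le> l" "real k * l \<le> 1"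
  shows "msum (replicate_mset k (sc l)) = Some (sc (real k * l))"
  using assms(2)
proof (induction k)
  case 0
  then show ?case by (simp add: act_zero one_closed)
next
  case (Suc k)
  have eq: "real (Suc k) * l = l + real k * l" by (simp add: algebra_simps)
  have nn: "0 \<le> real k * l" using assms by simp
  have "real k * l \<le> 1" "l \<le> 1" using Suc.prems eq nn assms by linarith+
  then show ?case using Suc.IH sc_add[of l "real k * l"] sc_closed[of l] sc_closed[of "real k * l"]
    Suc.prems eq nn assms by (simp add: msum_add_mset)
qed

text \<open>Division by \<open>k\<close> is expressed as left multiplication by a scalar, since that
  is the operation under which cones are stable. Right distributivity turns the sum of the scalars
  into \<open>1 \<odot> a\<close>.\<close>

lemma msum_replicate_mult:
  assumes "k > 0" "a \<in> C"
  shows "msum (replicate_mset k (sc (1 / real k) \<odot> a)) = Some a"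
proof -
  have s: "msum (replicate_mset k (sc (1 / real k))) = Some \<one>"
    using msum_replicate_sc[of "1 / real k" k] assms by (simp add: sc_1)
  have "msum (image_mset (\<lambda>c. c \<odot> a) (replicate_mset k (sc (1 / real k)))) = Some (\<one> \<odot> a)"
    by (rule msum_image[OF _ _ s]) (use assms mult_closed distrib_right in blast)+
  then show ?thesis using assms by (simp add: mult_one_left)
qed

end

section \<open>Cones stable under left multiplication\<close>

text \<open>\<open>(X, Y) \<in> R\<close> stands for \<open>Y - X \<in> Q\<close>, with \<open>Q\<close> a cone as in the introduction.\<close>

locale fs_module = convex_effect_monoid E act
  for E :: "('a, 'b) effect_monoid_scheme" and act +
  fixes R :: "('a multiset \<times> 'a multiset) set"
  assumes R_field: "(X, Y) \<in> R \<Longrightarrow> set_mset X \<subseteq> C \<and> set_mset Y \<subseteq> C"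
    and R_le: "X \<preceq> Y \<Longrightarrow> (X, Y) \<in> R"
    and R_trans: "(X, Y) \<in> R \<Longrightarrow> (Y, W) \<in> R \<Longrightarrow> (X, W) \<in> R"
    and R_add: "(X, Y) \<in> R \<Longrightarrow> set_mset W \<subseteq> C \<Longrightarrow> (X + W, Y + W) \<in> R"
    and R_cancel: "(X + W, Y + W) \<in> R \<Longrightarrow> (X, Y) \<in> R"
    and R_mult: "(X, Y) \<in> R \<Longrightarrow> c \<in> C \<Longrightarrow> (image_mset ((\<odot>) c) X, image_mset ((\<odot>) c) Y) \<in> R"
    and R_proper: "({#\<one>#}, {#}) \<notin> R"
begin

abbreviation rle :: "'a multiset \<Rightarrow> 'a multiset \<Rightarrow> bool" (infix "\<lessapprox>" 50) where
  "X \<lessapprox> Y \<equiv> (X, Y) \<in> R"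

lemma R_refl: "set_mset X \<subseteq> C \<Longrightarrow> X \<lessapprox> X"
  by (intro R_le fs_le_refl)

lemma R_add2: "X \<lessapprox> Y \<Longrightarrow> X' \<lessapprox> Y' \<Longrightarrow> X + X' \<lessapprox> Y + Y'"
  using R_add[of X Y X'] R_add[of X' Y' Y] R_field R_trans by (metis union_commute)

lemma R_msum: "msum X = Some a \<Longrightarrow> msum Y = Some b \<Longrightarrow> a \<sqsubseteq> b \<Longrightarrow> X \<lessapprox> Y"
  by (intro R_le fs_le_msum)

lemma R_pair:
  assumes "a \<in> C" "b \<in> C" "osum E a b = Some c"
  shows "{#a, b#} \<lessapprox> {#c#}" "{#c#} \<lessapprox> {#a, b#}"
  using R_msum[of "{#a,b#}" c "{#c#}" c] R_msum[of "{#c#}" c "{#a,b#}" c] assms osum_closed[OF assms]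
  by (simp_all add: msum_pair msum_single leq_refl)

text \<open>If a positive scalar were negligible, so would be some \<open>1/k\<close> below it.
  Adding \<open>k\<close> copies would then make the unit negligible, against
  \<open>R_proper\<close>.\<close>

lemma sc_empty:
  assumes "0 \<le> x" "x \<le> 1" "{#sc x#} \<lessapprox> {#}" shows "x = 0"
proof (rule ccontr)
  assume "x \<noteq> 0"
  then obtain k where k: "k > 0" "1 / real k \<le> x"
    using assms by (metis real_arch_inverse inverse_eq_divide less_eq_real_def neq0_conv)
  have x: "sc x \<in> C" "sc (1 / real k) \<in> C" using assms sc_closed k by auto
  have "{#sc (1 / real k)#} \<lessapprox> {#sc x#}"
    by (rule R_msum) (use assms k x in \<open>auto simp: msum_single intro: sc_mono\<close>)
  then have 1: "{#sc (1 / real k)#} \<lessapprox> {#}" using assms R_trans by blast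
  have 2: "replicate_mset n (sc (1 / real k)) \<lessapprox> {#}" for n
  proof (induction n)
    case 0 then show ?case by (simp add: R_refl)
  next
    case (Suc n) then show ?case using R_add2[OF 1 Suc] by simp
  qed
  have "{#\<one>#} \<lessapprox> replicate_mset k (sc (1 / real k))"
    by (rule R_msum[of _ \<one> _ \<one>]) (use k msum_replicate_sc[of "1 / real k" k]
      in \<open>auto simp: msum_single one_closed leq_refl sc_1\<close>)
  then show False using 2 R_trans R_proper by blast
qed

lemma sc_split:
  assumes "0 \<le> y" "y \<le> x" "x \<le> 1"
  shows "{#sc y, sc (x - y)#} \<lessapprox> {#sc x#}" "{#sc x#} \<lessapprox> {#sc y, sc (x - y)#}"
  using R_pair[of "sc y" "sc (x - y)" "sc x"] sc_add[of y "x - y"] sc_closed[of y] sc_closed[of "x - y"] assms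
  by auto

lemma sc_reflect:
  assumes "0 \<le> x" "x \<le> 1" "0 \<le> y" "y \<le> 1" "{#sc x#} \<lessapprox> {#sc y#}" shows "x \<le> y"
proof (rule ccontr)
  assume *: "\<not> x \<le> y"
  then have "{#sc y, sc (x - y)#} \<lessapprox> {#sc y#}" using sc_split(1)[of y x] assms R_trans by auto
  then have "{#sc (x - y)#} \<lessapprox> {#}" using R_cancel[of "{#sc (x - y)#}" "{#sc y#}" "{#}"] by (simp add: add_mset_commute)
  then show False using sc_empty[of "x - y"] assms * by simp
qed

lemma drop_left: "{#a, b#} \<lessapprox> W \<Longrightarrow> {#a#} \<lessapprox> W"
proof -
  assume *: "{#a, b#} \<lessapprox> W"
  then have C: "a \<in> C" "b \<in> C" using R_field[OF *] by auto
  have "{#} + {#a#} \<lessapprox> {#b#} + {#a#}"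
    by (intro R_add R_le fs_le_zero) (use C in auto)
  then show ?thesis using * R_trans[of "{#a#}" "{#a, b#}"] by (simp add: add_mset_commute)
qed

text \<open>As \<open>x + y\<close> might exceed 1, the sum of the two scalars cannot be formed in
  advance. Instead \<open>sc z\<close> is split at \<open>x\<close> and the common part
  cancelled.\<close>

lemma sc_pair_le:
  assumes "0 \<le> x" "x \<le> 1" "0 \<le> y" "y \<le> 1" "0 \<le> z" "z \<le> 1" "{#sc x, sc y#} \<lessapprox> {#sc z#}"
  shows "x + y \<le> z"
proof -
  have xz: "x \<le> z" using drop_left[OF assms(7)] sc_reflect assms by blast
  then have "{#sc x, sc y#} \<lessapprox> {#sc x, sc (z - x)#}" using sc_split(2)[of x z] assms R_trans by blast
  then have "{#sc y#} \<lessapprox> {#sc (z - x)#}"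
    using R_cancel[of "{#sc y#}" "{#sc x#}" "{#sc (z - x)#}"] by (simp add: add_mset_commute)
  then have "y \<le> z - x" using sc_reflect[of y "z - x"] assms xz by simp
  then show ?thesis by simp
qed

lemma sc_le_pair:
  assumes "0 \<le> x" "x \<le> 1" "0 \<le> y" "y \<le> 1" "0 \<le> z" "z \<le> 1" "{#sc z#} \<lessapprox> {#sc x, sc y#}"
  shows "z \<le> x + y"
proof (cases "z \<le> x")
  case False
  then have xz: "x \<le> z" by simp
  then have "{#sc x, sc (z - x)#} \<lessapprox> {#sc x, sc y#}" using sc_split(1)[of x z] assms R_trans by blast
  then have "{#sc (z - x)#} \<lessapprox> {#sc y#}"
    using R_cancel[of "{#sc (z - x)#}" "{#sc x#}" "{#sc y#}"] by (simp add: add_mset_commute)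
  then have "z - x \<le> y" using sc_reflect[of "z - x" y] assms xz by simp
  then show ?thesis by simp
qed (use assms in simp)

section \<open>The least scalar bound and the one-step extension of a cone\<close>

definition upper :: "'a \<Rightarrow> real" where
  "upper a = Inf {r \<in> {0..1}. {#a#} \<lessapprox> {#sc r#}}"

lemma upper_props:
  assumes a: "a \<in> C"
  shows upper_ge: "0 \<le> upper a" and upper_le_one: "upper a \<le> 1"
    and upper_le: "\<And>r. 0 \<le> r \<Longrightarrow> r \<le> 1 \<Longrightarrow> {#a#} \<lessapprox> {#sc r#} \<Longrightarrow> upper a \<le> r"
    and upper_approx: "\<And>e. e > 0 \<Longrightarrow> \<exists>r\<in>{0..1}. r < upper a + e \<and> {#a#} \<lessapprox> {#sc r#}"
proof -
  let ?S = "{r \<in> {0..1}. {#a#} \<lessapprox> {#sc r#}}"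
  have 1: "1 \<in> ?S"
    using R_msum[of "{#a#}" a "{#\<one>#}" \<one>] a by (simp add: msum_single one_closed leq_one sc_1)
  have bdd: "bdd_below ?S" by (rule bdd_belowI[of _ 0]) auto
  show "0 \<le> upper a" unfolding upper_def using 1 by (intro cInf_greatest) auto
  show le: "upper a \<le> r" if "0 \<le> r" "r \<le> 1" "{#a#} \<lessapprox> {#sc r#}" for r
    unfolding upper_def using that by (intro cInf_lower bdd) auto
  show "upper a \<le> 1" using le 1 by simp
  show "\<exists>r\<in>{0..1}. r < upper a + e \<and> {#a#} \<lessapprox> {#sc r#}" if "e > 0" for e
  proof -
    have "?S \<noteq> {}" "Inf ?S < upper a + e" using 1 that by (auto simp: upper_def)
    from cInf_lessD[OF this] show ?thesis by blast
  qed
qed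

text \<open>The relation of the cone \<open>Q + P (a - upper a)\<close>; the multiset \<open>D\<close> is the element of \<open>P\<close>.\<close>

definition extension :: "'a \<Rightarrow> ('a multiset \<times> 'a multiset) set" where
  "extension a = {(X, Y). set_mset X \<subseteq> C \<and> set_mset Y \<subseteq> C \<and> (\<exists>D. set_mset D \<subseteq> C \<and>
     X + image_mset (\<lambda>c. c \<odot> a) D \<lessapprox> Y + image_mset (\<lambda>c. c \<odot> sc (upper a)) D)}"

text \<open>For each \<open>c\<close> in \<open>D\<close>, distributivity gives
  \<open>c a + (1 - c) a = a\<close>. So the complements of the members of \<open>D\<close> sum to
  \<open>k - c\<close> in the notation of the introduction, where \<open>k\<close> is the size of
  \<open>D\<close>.\<close>

lemma image_compl_sum:
  assumes "a \<in> C" "set_mset D \<subseteq> C"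
  shows "image_mset (\<lambda>c. c \<odot> a) D + image_mset (\<lambda>c. ecompl E c \<odot> a) D \<lessapprox> replicate_mset (size D) a"
    "replicate_mset (size D) a \<lessapprox> image_mset (\<lambda>c. c \<odot> a) D + image_mset (\<lambda>c. ecompl E c \<odot> a) D"
  using assms(2)
proof (induction D)
  case empty
  { case 1 then show ?case by (simp add: R_refl) }
  { case 2 then show ?case by (simp add: R_refl) }
next
  case (add c D)
  have c: "c \<in> C" if "set_mset (add_mset c D) \<subseteq> C" using that by auto
  have pr: "osum E (c \<odot> a) (ecompl E c \<odot> a) = Some a" if "c \<in> C"
    using distrib_right[OF assms(1) that compl_closed[OF that] osum_compl[OF that]] assms by (simp add: mult_one_left)
  { case 1
    then show ?case using R_add2[OF R_pair(1)[OF _ _ pr] add(1)] c assms mult_closed compl_closed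
      by (simp add: add_mset_commute) }
  { case 2
    then show ?case using R_add2[OF R_pair(2)[OF _ _ pr] add(2)] c assms mult_closed compl_closed
      by (simp add: add_mset_commute) }
qed

lemma R_mult_image:
  assumes "set_mset D \<subseteq> C" "\<And>c. c \<in># D \<Longrightarrow> h c \<in> C" "{#a#} \<lessapprox> {#b#}"
  shows "image_mset (\<lambda>c. h c \<odot> a) D \<lessapprox> image_mset (\<lambda>c. h c \<odot> b) D"
  using assms(1,2)
proof (induction D)
  case empty then show ?case by (simp add: R_refl)
next
  case (add c D)
  have "{#h c \<odot> a#} \<lessapprox> {#h c \<odot> b#}" using R_mult[OF assms(3), of "h c"] add by simp
  then show ?case using R_add2[of "{#h c \<odot> a#}" "{#h c \<odot> b#}"] add by auto
qed

lemma extension_proper: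
  assumes a: "a \<in> C" shows "({#\<one>#}, {#}) \<notin> extension a"
proof
  let ?s = "upper a"
  assume "({#\<one>#}, {#}) \<in> extension a"
  then obtain D where D: "set_mset D \<subseteq> C"
    and 1: "{#\<one>#} + image_mset (\<lambda>c. c \<odot> a) D \<lessapprox> image_mset (\<lambda>c. c \<odot> sc ?s) D"
    by (auto simp: extension_def)
  define k where "k = size D"
  \<comment> \<open>An empty \<open>D\<close> would put the unit below zero in
    \<open>R\<close>.\<close>
  have k: "k > 0" using 1 R_proper by (cases "D = {#}") (auto simp: k_def nonempty_has_size)
  \<comment> \<open>The infimum need not be attained. An \<open>r\<close> less than
    \<open>1/k\<close> above it is good enough, because the argument ends by lowering
    \<open>r\<close> by \<open>1/k\<close>.\<close>
  obtain r where r: "0 \<le> r" "r \<le> 1" "r < ?s + 1 / real k" and ar: "{#a#} \<lessapprox> {#sc r#}"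
    using upper_approx[OF a, of "1 / real k"] k by auto
  have sr: "?s \<le> r" using upper_le[OF a] r ar by blast
  have scC: "sc r \<in> C" "sc ?s \<in> C" "sc (1 / real k) \<in> C"
    using r sr upper_ge[OF a] upper_le_one[OF a] k by (auto intro: sc_closed)
  have "{#sc ?s#} \<lessapprox> {#sc r#}"
    by (rule R_msum) (use sr r scC upper_ge[OF a] in \<open>auto simp: msum_single intro: sc_mono\<close>)
  then have 2: "image_mset (\<lambda>c. c \<odot> sc ?s) D \<lessapprox> image_mset (\<lambda>c. c \<odot> sc r) D"
    using R_mult_image[OF D, of "\<lambda>c. c"] D by blast
  have 3: "image_mset (\<lambda>c. ecompl E c \<odot> a) D \<lessapprox> image_mset (\<lambda>c. ecompl E c \<odot> sc r) D"
    using R_mult_image[OF D _ ar, of "ecompl E"] D compl_closed by blast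
  \<comment> \<open>With \<open>d\<close> standing for the sum of \<open>D\<close>, this adds
    \<open>(k - d) a \<le> (k - d) r\<close> to \<open>1 + d a \<le> d r\<close>. Collapsing both
    sides will give \<open>k a + 1 \<le> k r\<close>.\<close>
  have "({#\<one>#} + image_mset (\<lambda>c. c \<odot> a) D) + image_mset (\<lambda>c. ecompl E c \<odot> a) D
      \<lessapprox> image_mset (\<lambda>c. c \<odot> sc r) D + image_mset (\<lambda>c. ecompl E c \<odot> sc r) D"
    using R_add2[OF R_trans[OF 1 2] 3] .
  moreover have "replicate_mset k a + {#\<one>#}
      \<lessapprox> (image_mset (\<lambda>c. c \<odot> a) D + image_mset (\<lambda>c. ecompl E c \<odot> a) D) + {#\<one>#}"
    unfolding k_def by (intro R_add image_compl_sum a D) (simp add: one_closed)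
  moreover have "({#\<one>#} + image_mset (\<lambda>c. c \<odot> a) D) + image_mset (\<lambda>c. ecompl E c \<odot> a) D
      = (image_mset (\<lambda>c. c \<odot> a) D + image_mset (\<lambda>c. ecompl E c \<odot> a) D) + {#\<one>#}"
    by (simp only: ac_simps)
  ultimately have "replicate_mset k a + {#\<one>#} \<lessapprox>
      image_mset (\<lambda>c. c \<odot> sc r) D + image_mset (\<lambda>c. ecompl E c \<odot> sc r) D"
    using R_trans by simp
  then have "replicate_mset k a + {#\<one>#} \<lessapprox> replicate_mset k (sc r)"
    using image_compl_sum(1)[OF scC(1) D] R_trans unfolding k_def by blast
  \<comment> \<open>Divide by \<open>k\<close> through left multiplication; the \<open>k\<close>
    copies on each side then recombine to give \<open>a + 1/k \<le> r\<close>.\<close>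
  from R_mult[OF this scC(3)]
  have 4: "replicate_mset k (sc (1 / real k) \<odot> a) + {#sc (1 / real k)#}
      \<lessapprox> replicate_mset k (sc (1 / real k) \<odot> sc r)"
    using scC by (simp add: mult_one_right)
  have 5: "{#a#} + {#sc (1 / real k)#} \<lessapprox> replicate_mset k (sc (1 / real k) \<odot> a) + {#sc (1 / real k)#}"
    by (rule R_add, rule R_msum[OF msum_single msum_replicate_mult]) (use a k scC in \<open>auto intro: leq_refl\<close>)
  have 6: "replicate_mset k (sc (1 / real k) \<odot> sc r) \<lessapprox> {#sc r#}"
    by (rule R_msum[OF msum_replicate_mult msum_single]) (use k scC in \<open>auto intro: leq_refl\<close>)
  have 7: "{#sc (1 / real k), a#} \<lessapprox> {#sc r#}"
    using R_trans[OF R_trans[OF 5 4] 6] by (simp add: add_mset_commute)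
  \<comment> \<open>This keeps \<open>r - 1/k\<close> in the unit interval, so that it competes in
    the infimum defining \<open>upper a\<close>.\<close>
  have kr: "1 / real k \<le> r"
    using drop_left[OF 7] sc_reflect[of "1 / real k" r] r k by simp
  have "{#a#} + {#sc (1 / real k)#} \<lessapprox> {#sc (r - 1 / real k)#} + {#sc (1 / real k)#}"
    using R_trans[OF 7 sc_split(2)[of "1 / real k" r]] kr r k by (simp add: add_mset_commute)
  then have "{#a#} \<lessapprox> {#sc (r - 1 / real k)#}" by (rule R_cancel)
  then have "?s \<le> r - 1 / real k"
    by (rule upper_le[OF a, rotated 2]) (use kr r k in \<open>auto intro: order_trans[OF _ r(2)]\<close>)
  then show False using r by simp
qed

text \<open>The witnesses \<open>D\<close> form a left ideal: transitivity adds two of them, and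
  left multiplication by \<open>c\<close> maps \<open>D\<close> to \<open>c D\<close>, by
  associativity. The empty witness embeds the old relation.\<close>

lemma extension_module:
  assumes a: "a \<in> C" shows "fs_module E act (extension a)"
proof unfold_locales
  have sC: "sc (upper a) \<in> C" using upper_ge[OF a] upper_le_one[OF a] sc_closed by blast
  show "set_mset X \<subseteq> C \<and> set_mset Y \<subseteq> C" if "(X, Y) \<in> extension a" for X Y
    using that by (simp add: extension_def)
  show "(X, Y) \<in> extension a" if "X \<preceq> Y" for X Y
    using R_le[OF that] R_field[OF R_le[OF that]] by (auto simp: extension_def intro!: exI[of _ "{#}"])
  show "(X, W) \<in> extension a" if XY: "(X, Y) \<in> extension a" and YW: "(Y, W) \<in> extension a" for X Y W
  proof -
    let ?f = "\<lambda>D. image_mset (\<lambda>c. c \<odot> a) D" and ?g = "\<lambda>D. image_mset (\<lambda>c. c \<odot> sc (upper a)) D"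
    obtain D F where D: "set_mset D \<subseteq> C" "X + ?f D \<lessapprox> Y + ?g D"
      and F: "set_mset F \<subseteq> C" "Y + ?f F \<lessapprox> W + ?g F"
      using XY YW by (auto simp: extension_def)
    have "(X + ?f D) + ?f F \<lessapprox> (Y + ?g D) + ?f F"
      by (intro R_add D) (use F a mult_closed in auto)
    moreover have "(Y + ?f F) + ?g D \<lessapprox> (W + ?g F) + ?g D"
      by (intro R_add F) (use D sC mult_closed in auto)
    moreover have "(Y + ?g D) + ?f F = (Y + ?f F) + ?g D" by (simp only: ac_simps)
    ultimately have "(X + ?f D) + ?f F \<lessapprox> (W + ?g F) + ?g D" using R_trans by metis
    then have "X + ?f (D + F) \<lessapprox> W + ?g (D + F)" by (simp add: ac_simps)
    then show ?thesis using XY YW D F unfolding extension_def by (auto intro!: exI[of _ "D + F"])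
  qed
  show "(X + W, Y + W) \<in> extension a" if XY: "(X, Y) \<in> extension a" and W: "set_mset W \<subseteq> C" for X Y W
  proof -
    obtain D where D: "set_mset D \<subseteq> C"
      "X + image_mset (\<lambda>c. c \<odot> a) D \<lessapprox> Y + image_mset (\<lambda>c. c \<odot> sc (upper a)) D"
      using XY by (auto simp: extension_def)
    from R_add[OF D(2) W]
    have "(X + W) + image_mset (\<lambda>c. c \<odot> a) D \<lessapprox> (Y + W) + image_mset (\<lambda>c. c \<odot> sc (upper a)) D"
      by (simp only: ac_simps)
    then show ?thesis using D XY W by (auto simp: extension_def)
  qed
  show "(X, Y) \<in> extension a" if XY: "(X + W, Y + W) \<in> extension a" for X Y W
  proof -
    obtain D where D: "set_mset D \<subseteq> C"
      "X + W + image_mset (\<lambda>c. c \<odot> a) D \<lessapprox> Y + W + image_mset (\<lambda>c. c \<odot> sc (upper a)) D"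
      using XY by (auto simp: extension_def)
    then have "(X + image_mset (\<lambda>c. c \<odot> a) D) + W \<lessapprox> (Y + image_mset (\<lambda>c. c \<odot> sc (upper a)) D) + W"
      by (simp only: ac_simps)
    from R_cancel[OF this] show ?thesis using D XY by (auto simp: extension_def)
  qed
  show "(image_mset ((\<odot>) c) X, image_mset ((\<odot>) c) Y) \<in> extension a"
    if XY: "(X, Y) \<in> extension a" and c: "c \<in> C" for X Y c
  proof -
    obtain D where D: "set_mset D \<subseteq> C"
      "X + image_mset (\<lambda>c. c \<odot> a) D \<lessapprox> Y + image_mset (\<lambda>c. c \<odot> sc (upper a)) D"
      using XY by (auto simp: extension_def)
    have *: "image_mset ((\<odot>) c) (image_mset (\<lambda>c. c \<odot> b) D) = image_mset (\<lambda>c. c \<odot> b) (image_mset ((\<odot>) c) D)"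
      if "b \<in> C" for b
      unfolding image_mset.compositionality o_def
      by (rule image_mset_cong) (use that D c in \<open>auto simp: mult_assoc\<close>)
    have "set_mset X \<subseteq> C" "set_mset Y \<subseteq> C" using XY by (auto simp: extension_def)
    then have CC: "set_mset (image_mset ((\<odot>) c) X) \<subseteq> C" "set_mset (image_mset ((\<odot>) c) Y) \<subseteq> C"
      "set_mset (image_mset ((\<odot>) c) D) \<subseteq> C"
      using D(1) c mult_closed by (auto simp: subset_eq)
    have "image_mset ((\<odot>) c) X + image_mset (\<lambda>c. c \<odot> a) (image_mset ((\<odot>) c) D) \<lessapprox>
        image_mset ((\<odot>) c) Y + image_mset (\<lambda>c. c \<odot> sc (upper a)) (image_mset ((\<odot>) c) D)"
      using R_mult[OF D(2) c] unfolding image_mset_union *[OF a] *[OF sC] .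
    then show ?thesis unfolding extension_def mem_Collect_eq prod.case
      by (intro conjI CC exI[of _ "image_mset ((\<odot>) c) D"])
  qed
  show "({#\<one>#}, {#}) \<notin> extension a" by (rule extension_proper[OF a])
qed

lemma subset_extension: "R \<subseteq> extension a"
proof
  fix p assume p: "p \<in> R"
  obtain X Y where [simp]: "p = (X, Y)" by force
  show "p \<in> extension a" using p R_field by (auto simp: extension_def intro!: exI[of _ "{#}"])
qed

lemma upper_in_extension:
  assumes "a \<in> C" shows "({#sc (upper a)#}, {#a#}) \<in> extension a"
proof -
  have "sc (upper a) \<in> C" using upper_ge upper_le_one assms sc_closed by blast
  then show ?thesis using assms
    by (auto simp: extension_def mult_one_left one_closed add_mset_commute intro!: exI[of _ "{#\<one>#}"] R_refl)
qed

end

section \<open>Characters determine the order\<close>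

text \<open>Cauchy's equation. The defect \<open>d\<close> is additive, bounded, and zero at 1/2.
  Doubling the argument, modulo 1, doubles the defect, so boundedness leaves only the value
  0.\<close>

lemma additive_on_unit_interval:
  fixes g :: "real \<Rightarrow> real"
  assumes nonneg: "\<And>r. 0 \<le> r \<Longrightarrow> r \<le> 1 \<Longrightarrow> 0 \<le> g r"
    and add: "\<And>r t. 0 \<le> r \<Longrightarrow> 0 \<le> t \<Longrightarrow> r + t \<le> 1 \<Longrightarrow> g (r + t) = g r + g t"
    and r: "0 \<le> r" "r \<le> 1"
  shows "g r = r * g 1"
proof -
  define d where "d x = g x - x * g 1" for x
  have d_add: "d (x + y) = d x + d y" if "0 \<le> x" "0 \<le> y" "x + y \<le> 1" for x y
    using add[OF that] by (simp add: d_def algebra_simps)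
  have half: "d (1/2) = 0"
    using d_add[of "1/2" "1/2"] by (simp add: d_def)
  have bound: "\<bar>d x\<bar> \<le> g 1 / 2 ^ n" if "0 \<le> x" "x \<le> 1" for n x
    using that
  proof (induction n arbitrary: x)
    case 0
    have "g x \<le> g 1" using add[of x "1 - x"] nonneg[of "1 - x"] 0 by simp
    moreover have "x * g 1 \<le> g 1" "0 \<le> x * g 1" using 0 nonneg[of 1] by (auto intro: mult_left_le_one_le)
    ultimately show ?case using nonneg[of x] 0 unfolding d_def power_0 div_by_1 by linarith
  next
    case (Suc n)
    show ?case
    proof (cases "x \<le> 1/2")
      case True
      then have "d (2 * x) = 2 * d x" using d_add[of x x] Suc by simp
      then show ?thesis using Suc.IH[of "2 * x"] Suc.prems True by (simp add: abs_mult)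
    next
      case False
      have "d x = d (x - 1/2)" using d_add[of "1/2" "x - 1/2"] half False Suc.prems by simp
      then have "d (2 * x - 1) = 2 * d x" using d_add[of "x - 1/2" "x - 1/2"] False Suc.prems by simp
      then show ?thesis using Suc.IH[of "2 * x - 1"] Suc.prems False by (simp add: abs_mult)
    qed
  qed
  have "(\<lambda>n. g 1 / 2 ^ n) \<longlonglongrightarrow> 0" by real_asymp
  then have "\<bar>d r\<bar> \<le> 0" by (rule LIMSEQ_le_const) (use bound r in blast)
  then show ?thesis by (simp add: d_def)
qed

text \<open>Extensionality makes a character determined by its values on the carrier, so that
  evaluations separate characters.\<close>

definition character :: "('a, 'b) effect_monoid_scheme \<Rightarrow> ('a \<Rightarrow> real) \<Rightarrow> bool" where
  "character E f \<longleftrightarrow> f \<in> ecarrier E \<rightarrow>\<^sub>E {0..1} \<and> f (eone E) = 1 \<and>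
     (\<forall>a\<in>ecarrier E. \<forall>b\<in>ecarrier E. \<forall>c. osum E a b = Some c \<longrightarrow> f c = f a + f b) \<and>
     (\<forall>a\<in>ecarrier E. \<forall>b\<in>ecarrier E. f (emult E a b) = f a * f b)"

locale maximal_fs_module = fs_module E act R
  for E :: "('a, 'b) effect_monoid_scheme" and act R +
  assumes maximal: "fs_module E act R' \<Longrightarrow> R \<subseteq> R' \<Longrightarrow> R' = R"
begin

text \<open>By maximality the extension at \<open>a\<close> is \<open>R\<close> itself. Up to
  arbitrarily small errors, every element is thus equivalent to a scalar modulo
  \<open>R\<close>.\<close>

lemma sc_upper_le: "a \<in> C \<Longrightarrow> {#sc (upper a)#} \<lessapprox> {#a#}"
  using maximal extension_module subset_extension upper_in_extension by metis

lemma upper_mono: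
  assumes ab: "{#a#} \<lessapprox> {#b#}" shows "upper a \<le> upper b"
proof (rule field_le_epsilon)
  fix e :: real assume "e > 0"
  have C: "a \<in> C" "b \<in> C" using R_field[OF ab] by auto
  obtain r where r: "0 \<le> r" "r \<le> 1" "r < upper b + e" "{#b#} \<lessapprox> {#sc r#}"
    using upper_approx[OF C(2) \<open>e > 0\<close>] by auto
  then have "upper a \<le> r" using upper_le[OF C(1)] R_trans[OF ab] by blast
  then show "upper a \<le> upper b + e" using r by simp
qed

lemma upper_one: "upper \<one> = 1"
proof (rule antisym)
  show "1 \<le> upper \<one>"
  proof (rule field_le_epsilon)
    fix e :: real assume "e > 0"
    then obtain r where "0 \<le> r" "r \<le> 1" "r < upper \<one> + e" "{#\<one>#} \<lessapprox> {#sc r#}"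
      using upper_approx[OF one_closed \<open>e > 0\<close>] by auto
    then show "1 \<le> upper \<one> + e" using sc_reflect[of 1 r] by (simp add: sc_1)
  qed
qed (rule upper_le_one[OF one_closed])

text \<open>Chains of the form \<open>upper a + upper b \<le> a + b = c \<le> r\<close> and
  \<open>upper c \<le> c = a + b \<le> r + t\<close> modulo \<open>R\<close>, with \<open>r\<close>
  and \<open>t\<close> approximating the infima, are compared as scalars.\<close>

lemma upper_add:
  assumes "a \<in> C" "b \<in> C" "osum E a b = Some c"
  shows "upper c = upper a + upper b"
proof (rule antisym)
  have c: "c \<in> C" using assms osum_closed by blast
  have ge: "0 \<le> upper x" "upper x \<le> 1" if "x \<in> C" for x using that upper_ge upper_le_one by blast+
  show "upper a + upper b \<le> upper c"
  proof (rule field_le_epsilon)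
    fix e :: real assume "e > 0"
    obtain r where r: "0 \<le> r" "r \<le> 1" "r < upper c + e" "{#c#} \<lessapprox> {#sc r#}"
      using upper_approx[OF c \<open>e > 0\<close>] by auto
    have "{#sc (upper a), sc (upper b)#} \<lessapprox> {#a, b#}"
      using R_add2[OF sc_upper_le[OF assms(1)] sc_upper_le[OF assms(2)]] by (simp add: add_mset_commute)
    then have "{#sc (upper a), sc (upper b)#} \<lessapprox> {#sc r#}"
      using R_pair(1)[OF assms] r R_trans by blast
    then have "upper a + upper b \<le> r" by (intro sc_pair_le ge r assms)
    then show "upper a + upper b \<le> upper c + e" using r by simp
  qed
  show "upper c \<le> upper a + upper b"
  proof (rule field_le_epsilon)
    fix e :: real assume "e > 0"
    then have e: "e / 2 > 0" by simp
    obtain r t where r: "0 \<le> r" "r \<le> 1" "r < upper a + e / 2" "{#a#} \<lessapprox> {#sc r#}"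
      and t: "0 \<le> t" "t \<le> 1" "t < upper b + e / 2" "{#b#} \<lessapprox> {#sc t#}"
      using upper_approx[OF assms(1) e] upper_approx[OF assms(2) e] by auto
    have "{#a, b#} \<lessapprox> {#sc r, sc t#}" using R_add2[OF r(4) t(4)] by (simp add: add_mset_commute)
    then have "{#sc (upper c)#} \<lessapprox> {#sc r, sc t#}"
      using sc_upper_le[OF c] R_pair(2)[OF assms] R_trans by blast
    then have "upper c \<le> r + t" by (intro sc_le_pair ge c r t)
    then show "upper c \<le> upper a + upper b + e" using r t by simp
  qed
qed

text \<open>As a function of \<open>r\<close> the left side is additive and nonnegative, hence
  linear.\<close>

lemma upper_mult_sc:
  assumes c: "c \<in> C" and r: "0 \<le> r" "r \<le> 1"
  shows "upper (c \<odot> sc r) = r * upper c"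
proof -
  have "upper (c \<odot> sc r) = r * upper (c \<odot> sc 1)"
    by (rule additive_on_unit_interval[of "\<lambda>r. upper (c \<odot> sc r)", OF _ _ r])
      (use c mult_closed sc_closed sc_add distrib_left in \<open>auto intro!: upper_ge upper_add\<close>)
  then show ?thesis using c by (simp add: sc_1 mult_one_right)
qed

text \<open>Squeeze \<open>a\<close> between \<open>sc (upper a)\<close> and scalars slightly above
  it, multiply from the left by \<open>c\<close>, and use linearity in the scalar.\<close>

lemma upper_mult:
  assumes "c \<in> C" "a \<in> C" shows "upper (c \<odot> a) = upper c * upper a"
proof (rule antisym)
  have c: "0 \<le> upper c" "upper c \<le> 1" using assms upper_ge upper_le_one by blast+
  show "upper (c \<odot> a) \<le> upper c * upper a"
  proof (rule field_le_epsilon)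
    fix e :: real assume "e > 0"
    obtain r where r: "0 \<le> r" "r \<le> 1" "r < upper a + e" "{#a#} \<lessapprox> {#sc r#}"
      using upper_approx[OF assms(2) \<open>e > 0\<close>] by auto
    have "upper (c \<odot> a) \<le> upper (c \<odot> sc r)" using upper_mono R_mult[OF r(4) assms(1)] by simp
    also have "\<dots> = r * upper c" by (rule upper_mult_sc) fact+
    also have "\<dots> \<le> (upper a + e) * upper c" using r c by (intro mult_right_mono) auto
    also have "\<dots> \<le> upper c * upper a + e"
      using c \<open>e > 0\<close> by (simp add: algebra_simps mult_left_le)
    finally show "upper (c \<odot> a) \<le> upper c * upper a + e" .
  qed
  have "upper a * upper c = upper (c \<odot> sc (upper a))"
    using upper_mult_sc[of c "upper a"] assms upper_ge upper_le_one by simp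
  also have "\<dots> \<le> upper (c \<odot> a)"
    using upper_mono R_mult[OF sc_upper_le[OF assms(2)] assms(1)] by simp
  finally show "upper c * upper a \<le> upper (c \<odot> a)" by (simp add: mult.commute)
qed

lemma character_upper: "character E (restrict upper C)"
  unfolding character_def
proof (intro conjI ballI allI impI)
  show "restrict upper C \<in> C \<rightarrow>\<^sub>E {0..1}" using upper_ge upper_le_one by simp
  show "restrict upper C \<one> = 1" by (simp add: one_closed upper_one)
  fix a b assume ab: "a \<in> C" "b \<in> C"
  show "restrict upper C c = restrict upper C a + restrict upper C b" if "osum E a b = Some c" for c
    using upper_add[OF ab that] osum_closed[OF ab that] ab by simp
  show "restrict upper C (a \<odot> b) = restrict upper C a * restrict upper C b"
    using upper_mult[OF ab] mult_closed[OF ab] ab by simp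
qed

end

section \<open>Maximal cones, the Archimedean property and separation by characters\<close>

context convex_effect_monoid
begin

text \<open>Each closure condition has at most two premises about the relation, and these lie in a
  common member of the chain; properness holds in every member.\<close>

lemma fs_module_Union_chain:
  assumes "\<C> \<noteq> {}" "subset.chain {R. fs_module E act R} \<C>"
  shows "fs_module E act (\<Union>\<C>)"
proof unfold_locales
  have mod: "fs_module E act R" if "R \<in> \<C>" for R using that assms by (auto simp: subset.chain_def)
  have two: "\<exists>R\<in>\<C>. p \<in> R \<and> q \<in> R" if "p \<in> \<Union>\<C>" "q \<in> \<Union>\<C>" for p q
    using that assms(2) unfolding subset_chain_def by blast
  show "set_mset X \<subseteq> C \<and> set_mset Y \<subseteq> C" if "(X, Y) \<in> \<Union>\<C>" for X Y
    using that by (elim UnionE) (rule fs_module.R_field[OF mod])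
  show "(X, Y) \<in> \<Union>\<C>" if "X \<preceq> Y" for X Y
  proof -
    obtain R where "R \<in> \<C>" using assms by blast
    then show ?thesis using fs_module.R_le[OF mod that] by blast
  qed
  show "(X, W) \<in> \<Union>\<C>" if "(X, Y) \<in> \<Union>\<C>" "(Y, W) \<in> \<Union>\<C>" for X Y W
    using two[OF that] by (elim bexE conjE) (rule UnionI, assumption, rule fs_module.R_trans[OF mod])
  show "(X + W, Y + W) \<in> \<Union>\<C>" if "(X, Y) \<in> \<Union>\<C>" "set_mset W \<subseteq> C" for X Y W
    using that by (elim UnionE) (rule UnionI, assumption, rule fs_module.R_add[OF mod])
  show "(X, Y) \<in> \<Union>\<C>" if "(X + W, Y + W) \<in> \<Union>\<C>" for X Y W
    using that by (elim UnionE) (rule UnionI, assumption, rule fs_module.R_cancel[OF mod])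
  show "(image_mset ((\<odot>) c) X, image_mset ((\<odot>) c) Y) \<in> \<Union>\<C>" if "(X, Y) \<in> \<Union>\<C>" "c \<in> C" for X Y c
    using that by (elim UnionE) (rule UnionI, assumption, rule fs_module.R_mult[OF mod])
  show "({#\<one>#}, {#}) \<notin> \<Union>\<C>"
    using fs_module.R_proper[OF mod] by blast
qed

lemma maximal_fs_module_exists:
  assumes "fs_module E act R0"
  obtains R where "maximal_fs_module E act R" "R0 \<subseteq> R"
proof -
  let ?A = "{R. fs_module E act R \<and> R0 \<subseteq> R}"
  have "\<exists>R\<in>?A. \<forall>X\<in>?A. R \<subseteq> X \<longrightarrow> X = R"
  proof (rule subset_Zorn_nonempty)
    show "?A \<noteq> {}" using assms by blast
    fix \<C> assume c: "\<C> \<noteq> {}" "subset.chain ?A \<C>"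
    then have "subset.chain {R. fs_module E act R} \<C>" by (auto simp: subset_chain_def)
    from fs_module_Union_chain[OF c(1) this] show "\<Union>\<C> \<in> ?A"
      using c unfolding subset_chain_def by blast
  qed
  then obtain R where "R \<in> ?A" "\<forall>X\<in>?A. R \<subseteq> X \<longrightarrow> X = R" by blast
  then show thesis using that[of R]
    by (auto simp: maximal_fs_module_def maximal_fs_module_axioms_def)
qed

lemma fs_module_fs_le:
  assumes "\<one> \<noteq> \<zero>" shows "fs_module E act {(X, Y). X \<preceq> Y}"
proof unfold_locales
  show "set_mset X \<subseteq> C \<and> set_mset Y \<subseteq> C" if "(X, Y) \<in> {(X, Y). X \<preceq> Y}" for X Y
    using that by (simp add: fs_le_def)
  show "({#\<one>#}, {#}) \<notin> {(X, Y). X \<preceq> Y}" using fs_le_empty assms by blast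
qed (use fs_le_trans fs_le_add fs_le_cancel fs_le_mult in blast)+

text \<open>The Archimedean property. If \<open>s\<close> is the supremum and
  \<open>s + d = 1/2\<close>, then \<open>d\<close> lies below every \<open>1/2^(n+1)\<close>, hence
  so does \<open>e = d + d\<close>. So \<open>1/2 - e\<close> is also an upper bound, giving
  \<open>e + s \<le> 1/2 = d + s\<close> and \<open>e \<le> d\<close>. Then
  \<open>d + d = d\<close>, and \<open>d\<close> vanishes.\<close>

lemma esup_half:
  assumes "omega_complete E"
  shows "is_esup E (range (\<lambda>n. sc (1/2 - 1/2^(n+1)))) (sc (1/2))"
proof -
  define u where "u n = sc (1/2 - 1/2^(n+1))" for n :: nat
  have p: "0 < 1/(2::real)^n" "1/(2::real)^(n+1) \<le> 1/2" "1/(2::real)^(Suc n) \<le> 1/2^n" for n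
    by (auto simp: field_simps)
  have uC: "u n \<in> C" for n unfolding u_def using p[of n] by (intro sc_closed) (auto intro: order_trans)
  have hC: "sc (1/2) \<in> C" by (rule sc_closed) auto
  have "u n \<sqsubseteq> u (Suc n)" for n
    unfolding u_def using p[of n] p[of "Suc n"] by (intro sc_mono) (auto simp: field_simps)
  then obtain s where s: "is_esup E (range u) s"
    using assms uC unfolding omega_complete_def by blast
  then have sC: "s \<in> C" by (simp add: is_esup_def)
  have ub: "u n \<sqsubseteq> sc (1/2)" for n
    unfolding u_def using p[of n] by (intro sc_mono) (auto simp: field_simps)
  then have "s \<sqsubseteq> sc (1/2)" using s hC by (auto simp: is_esup_def)
  then obtain d where d: "d \<in> C" "osum E s d = Some (sc (1/2))" by (auto simp: ele_def)
  have split: "osum E (sc (1/2^(n+1))) (u n) = Some (sc (1/2))" for n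
    using sc_add[of "1/2^(n+1)" "1/2 - 1/2^(n+1)"] p[of n] unfolding u_def by (simp add: field_simps)
  have epsC: "sc (1/2^n) \<in> C" for n using p by (intro sc_closed) auto
  have d_le: "d \<sqsubseteq> sc (1/2^(n+1))" for n
  proof -
    have "u n \<sqsubseteq> s" using s by (auto simp: is_esup_def)
    then obtain c where c: "osum E d (u n) = Some c" "c \<sqsubseteq> sc (1/2)"
      using leq_osum_mono[OF uC d(1) _ leq_refl d(2)] d osum_comm uC by metis
    then show ?thesis using leq_osum_cancel[OF d(1) epsC uC c(1) split c(2)] by blast
  qed
  \<comment> \<open>Doubling costs one power of 2, so \<open>d_le\<close> is used one index further
    on.\<close>
  have dd: "\<exists>e. osum E d d = Some e \<and> e \<sqsubseteq> sc (1/2^(n+1))" for n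
  proof -
    have "osum E (sc (1/2^(n+2))) (sc (1/2^(n+2))) = Some (sc (1/2^(n+1)))"
      using sc_add[of "1/2^(n+2)" "1/2^(n+2)"] p[of "n+1"] by simp
    then have h: "osum E (sc (1/2^(n+1+1))) (sc (1/2^(n+1+1))) = Some (sc (1/2^(n+1)))" by simp
    obtain c where "osum E d d = Some c" "c \<sqsubseteq> sc (1/2^(n+1))"
      using leq_osum_mono[OF d(1) d(1) d_le d_le h] .
    then show ?thesis by blast
  qed
  obtain e where e1: "osum E d d = Some e" using dd[of 0] by blast
  have e: "osum E d d = Some e" "e \<sqsubseteq> sc (1/2^(n+1))" for n using dd[of n] e1 by simp_all
  have eC: "e \<in> C" using e d osum_closed by blast
  obtain x where x: "x \<in> C" "osum E e x = Some (sc (1/2))"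
    using e(2)[of 0] by (auto simp: ele_def)
  have "u n \<sqsubseteq> x" for n
  proof -
    obtain c where c: "osum E e (u n) = Some c" "c \<sqsubseteq> sc (1/2)"
      using leq_osum_mono[OF eC uC e(2) leq_refl split] uC by blast
    show ?thesis by (rule leq_osum_cancel[OF uC x(1) eC _ _ c(2)]) (use c x eC uC osum_comm in auto)
  qed
  then have "s \<sqsubseteq> x" using s x by (auto simp: is_esup_def)
  then obtain c where c: "osum E e s = Some c" "c \<sqsubseteq> sc (1/2)"
    using leq_osum_mono[OF eC sC leq_refl _ x(2)] eC by blast
  have "e \<sqsubseteq> d"
    by (rule leq_osum_cancel[OF eC d(1) sC c(1) _ c(2)]) (use d sC osum_comm in metis)
  moreover have "d \<sqsubseteq> e" using e d leq_osum by blast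
  ultimately have "e = d" using leq_antisym eC by blast
  then have "d = \<zero>" using osum_cancel[OF d(1) d(1) zero_closed _ osum_zero[OF d(1)]] e by simp
  then have "s = sc (1/2)" using d osum_zero[OF sC] by simp
  then show ?thesis using s unfolding u_def by simp
qed

lemma sc_compl:
  assumes "0 \<le> r" "r \<le> 1" shows "ecompl E (sc r) = sc (1 - r)"
  using compl_unique[of "sc r" "sc (1 - r)"] sc_add[of r "1 - r"] assms sc_closed[of r] sc_closed[of "1 - r"]
  by (simp add: sc_1)

lemma character_zero_one: assumes "character E f" "a \<in> C" shows "0 \<le> f a" "f a \<le> 1"
  using assms by (auto simp: character_def PiE_iff)

lemma character_add: "character E f \<Longrightarrow> a \<in> C \<Longrightarrow> b \<in> C \<Longrightarrow> osum E a b = Some c \<Longrightarrow> f c = f a + f b"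
  by (simp add: character_def)

lemma character_compl:
  assumes "character E f" "a \<in> C" shows "f (ecompl E a) = 1 - f a"
  using character_add[OF assms(1,2) compl_closed osum_compl] assms by (simp add: character_def)

lemma character_act:
  assumes f: "character E f" and a: "a \<in> C" and r: "0 \<le> r" "r \<le> 1" shows "f (act r a) = r * f a"
proof -
  have "f (act r a) = r * f (act 1 a)"
    by (rule additive_on_unit_interval[of "\<lambda>r. f (act r a)", OF _ _ r])
      (use f a act_closed act_add character_zero_one in \<open>auto intro!: character_add\<close>)
  then show ?thesis using a by (simp add: act_one)
qed

lemma character_leq:
  assumes "character E f" "a \<in> C" "a \<sqsubseteq> b" shows "f a \<le> f b"
  using assms character_add character_zero_one unfolding ele_def by force

text \<open>By contraposition. The order itself serves as the first cone, one extension step fixes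
  the value at a well-chosen \<open>e\<close>, and a maximal cone above it yields a character with
  \<open>f e > 1/2\<close>, which means \<open>f a > f b\<close>.\<close>

lemma leq_from_characters:
  assumes omega: "omega_complete E" and ab: "a \<in> C" "b \<in> C"
    and le: "\<And>f. character E f \<Longrightarrow> f a \<le> f b"
  shows "a \<sqsubseteq> b"
proof (rule ccontr)
  assume nle: "\<not> a \<sqsubseteq> b"
  \<comment> \<open>If 1 = 0, any two elements are comparable. So here the order is a proper
    cone.\<close>
  have ne: "\<one> \<noteq> \<zero>"
    using nle ab leq_one leq_zero leq_trans leq_antisym by (metis zero_closed)
  \<comment> \<open>\<open>e\<close> is half of \<open>a\<close> plus half of the complement of
    \<open>b\<close>. As the halves of \<open>b\<close> and its complement sum to 1/2,
    \<open>e \<le> 1/2\<close> would give \<open>a \<le> b\<close>: comparison with \<open>b\<close>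
    becomes comparison with a scalar.\<close>
  define e where "e = the (osum E (act (1/2) a) (act (1/2) (ecompl E b)))"
  have hC: "sc (1/2) \<in> C" "act (1/2) a \<in> C" "act (1/2) b \<in> C" "act (1/2) (ecompl E b) \<in> C"
    by (intro act_closed one_closed compl_closed ab; simp)+
  have hh: "osum E (act (1/2) b) (act (1/2) (ecompl E b)) = Some (sc (1/2))"
    using act_osum[OF _ _ ab(2) compl_closed[OF ab(2)] osum_compl[OF ab(2)], of "1/2"] by simp
  have h1: "osum E (sc (1/2)) (sc (1/2)) = Some \<one>" using half_add[OF one_closed] .
  have "act (1/2) a \<sqsubseteq> sc (1/2)" "act (1/2) (ecompl E b) \<sqsubseteq> sc (1/2)"
    by (intro act_mono leq_one ab compl_closed; simp)+
  from leq_osum_mono[OF hC(2,4) this h1]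
  have e: "osum E (act (1/2) a) (act (1/2) (ecompl E b)) = Some e" unfolding e_def by force
  have eC: "e \<in> C" using e hC osum_closed by blast
  have e_nle: "\<not> e \<sqsubseteq> sc (1/2)"
    using leq_osum_cancel[OF hC(2,3,4) e hh] half_reflect[OF ab] nle by blast
  interpret M0: fs_module E act "{(X, Y). X \<preceq> Y}" by (rule fs_module_fs_le[OF ne])
  have "1/2 < M0.upper e"
  proof (rule ccontr)
    assume *: "\<not> 1/2 < M0.upper e"
    \<comment> \<open>Complements turn upper bounds of \<open>e\<close> tending to 1/2 into an
      increasing sequence of lower bounds, the one treated in \<open>esup_half\<close>.\<close>
    have "sc (1/2 - 1/2^(n+1)) \<sqsubseteq> ecompl E e" for n
    proof -
      have p: "0 < 1/(2::real)^(n+1)" "1/(2::real)^(n+1) \<le> 1/2" by (auto simp: field_simps)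
      obtain r where r: "0 \<le> r" "r \<le> 1" "r < M0.upper e + 1/2^(n+1)" "{#e#} \<preceq> {#sc r#}"
        using M0.upper_approx[OF eC p(1)] by auto
      have "e \<sqsubseteq> sc r" using r fs_le_single by blast
      then have "ecompl E (sc r) \<sqsubseteq> ecompl E e" using leq_compl_antimono eC r sc_closed by blast
      then have "sc (1 - r) \<sqsubseteq> ecompl E e" using sc_compl r by simp
      moreover have "sc (1/2 - 1/2^(n+1)) \<sqsubseteq> sc (1 - r)" using r * p by (intro sc_mono) auto
      moreover have "sc (1/2 - 1/2^(n+1)) \<in> C" by (rule sc_closed) (use p in linarith)+
      ultimately show ?thesis using leq_trans by blast
    qed
    then have "sc (1/2) \<sqsubseteq> ecompl E e"
      using esup_half[OF omega] compl_closed[OF eC] unfolding is_esup_def by blast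
    then have "ecompl E (ecompl E e) \<sqsubseteq> ecompl E (sc (1/2))"
      using leq_compl_antimono hC compl_closed eC by blast
    then show False using e_nle eC compl_compl sc_compl[of "1/2"] by simp
  qed
  moreover
  obtain R where R: "maximal_fs_module E act R" "M0.extension e \<subseteq> R"
    using maximal_fs_module_exists[OF M0.extension_module[OF eC]] .
  interpret M1: maximal_fs_module E act R by fact
  have "({#sc (M0.upper e)#}, {#e#}) \<in> R" using M0.upper_in_extension[OF eC] R by blast
  \<comment> \<open>\<open>R\<close> contains the extension at \<open>e\<close>, where
    \<open>sc (M0.upper e)\<close> lies below \<open>e\<close>; enlarging the cone therefore cannot
    lower the value.\<close>
  have "M0.upper e \<le> M1.upper e"
  proof (rule field_le_epsilon)
    fix x :: real assume "x > 0"
    obtain r where r: "0 \<le> r" "r \<le> 1" "r < M1.upper e + x" "({#e#}, {#sc r#}) \<in> R"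
      using M1.upper_approx[OF eC \<open>x > 0\<close>] by auto
    have "({#sc (M0.upper e)#}, {#sc r#}) \<in> R"
      using M0.upper_in_extension[OF eC] R(2) r(4) M1.R_trans by blast
    then have "M0.upper e \<le> r"
      by (rule M1.sc_reflect[OF M0.upper_ge[OF eC] M0.upper_le_one[OF eC] r(1,2)])
    then show "M0.upper e \<le> M1.upper e + x" using r by simp
  qed
  moreover define f where "f = restrict M1.upper C"
  have f: "character E f" unfolding f_def by (rule M1.character_upper)
  have "f e = 1/2 * f a + 1/2 * (1 - f b)"
    using character_add[OF f hC(2,4) e] character_act[OF f ab(1), of "1/2"]
      character_act[OF f compl_closed[OF ab(2)], of "1/2"] character_compl[OF f ab(2)] by simp
  moreover have "f e = M1.upper e" using eC by (simp add: f_def)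
  ultimately show False using le[OF f] by argo
qed

end

section \<open>The Gelfand representation\<close>

text \<open>The weaker separation instances come first because the library instance for metric spaces
  with countable index set would otherwise clash with the one for Hausdorff spaces.\<close>

lemma open_coordinate: "open U \<Longrightarrow> open {f :: 'a \<Rightarrow> 'b::topological_space. f i \<in> U}"
  using open_vimage[OF _ continuous_on_product_coordinates[of i]] by (simp add: vimage_def)

instance "fun" :: (type, t0_space) t0_space
proof
  fix f g :: "'a \<Rightarrow> 'b" assume "f \<noteq> g"
  then obtain i U where "open U" "\<not> (f i \<in> U \<longleftrightarrow> g i \<in> U)"
    using t0_space_class.t0_space by (metis ext)
  then show "\<exists>U. open U \<and> \<not> (f \<in> U \<longleftrightarrow> g \<in> U)"
    using open_coordinate[of U i] by (intro exI[of _ "{f. f i \<in> U}"]) auto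
qed

instance "fun" :: (type, t1_space) t1_space
proof
  fix f g :: "'a \<Rightarrow> 'b" assume "f \<noteq> g"
  then obtain i U where "open U" "f i \<in> U" "g i \<notin> U"
    using t1_space_class.t1_space by (metis ext)
  then show "\<exists>U. open U \<and> f \<in> U \<and> g \<notin> U"
    using open_coordinate[of U i] by (intro exI[of _ "{f. f i \<in> U}"]) auto
qed

instance "fun" :: (type, t2_space) t2_space
proof
  fix f g :: "'a \<Rightarrow> 'b" assume "f \<noteq> g"
  then obtain i U V where "open U" "open V" "f i \<in> U" "g i \<in> V" "U \<inter> V = {}"
    using hausdorff by (metis ext)
  then show "\<exists>U V. open U \<and> open V \<and> f \<in> U \<and> g \<in> V \<and> U \<inter> V = {}"
    using open_coordinate[of U i] open_coordinate[of V i]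
    by (intro exI[of _ "{f. f i \<in> U}"] exI[of _ "{f. f i \<in> V}"]) auto
qed

definition character_space :: "('a, 'b) effect_monoid_scheme \<Rightarrow> ('a \<Rightarrow> real) set" where
  "character_space E = {f. character E f}"

text \<open>Tychonoff: the characters form a closed subset of a product of compact sets. Coordinates
  outside the carrier range over \<open>{undefined}\<close>, which encodes extensionality.\<close>

lemma compact_character_space: "compact (character_space E)"
proof -
  let ?C = "ecarrier E"
  let ?B = "Pi\<^sub>E UNIV (\<lambda>i. if i \<in> ?C then {0..1::real} else {undefined})"
  let ?S = "{f :: 'a \<Rightarrow> real. f (eone E) = 1 \<and>
     (\<forall>a b c. a \<in> ?C \<longrightarrow> b \<in> ?C \<longrightarrow> osum E a b = Some c \<longrightarrow> f c = f a + f b) \<and>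
     (\<forall>a b. a \<in> ?C \<longrightarrow> b \<in> ?C \<longrightarrow> f (emult E a b) = f a * f b)}"
  have "compactin (product_topology (\<lambda>i. euclidean) UNIV) ?B"
    unfolding compactin_PiE by (auto simp: compactin_euclidean_iff)
  then have "compact ?B" by (simp add: euclidean_product_topology)
  moreover have "closed ?S"
    by (intro closed_Collect_conj closed_Collect_all closed_Collect_imp open_Collect_const
        closed_Collect_eq continuous_intros) (auto intro: continuous_on_product_coordinates)
  moreover have "character_space E = ?S \<inter> ?B"
    unfolding character_space_def character_def
    by (intro set_eqI iffI) (auto simp: PiE_iff extensional_def Pi_iff split: if_splits)
  ultimately show ?thesis by (simp add: closed_Int_compact)
qed

lemma continuous_on_evaluation: "continuous_on S (\<lambda>f :: 'a \<Rightarrow> real. f a)"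
  by (rule continuous_on_subset[OF continuous_on_product_coordinates]) simp

lemma Hausdorff_space_top_of_set: "Hausdorff_space (top_of_set (S :: 'a::t2_space set))"
  by (rule Hausdorff_space_subtopology) (simp add: Hausdorff_space_def disjnt_def, metis hausdorff)

section \<open>Realising continuous functions on the character space by elements\<close>

locale omega_complete_convex_effect_monoid = convex_effect_monoid E act
  for E :: "('a, 'b) effect_monoid_scheme" and act +
  assumes omega: "omega_complete E"
begin

abbreviation K :: "('a \<Rightarrow> real) set" where "K \<equiv> character_space E"

lemma leq_iff:
  assumes "a \<in> C" "b \<in> C" shows "a \<sqsubseteq> b \<longleftrightarrow> (\<forall>f\<in>K. f a \<le> f b)"
  using leq_from_characters[OF omega assms] character_leq assms by (auto simp: character_space_def)

lemma K_character: "f \<in> K \<Longrightarrow> character E f"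
  by (simp add: character_space_def)

lemma K_zero_one: "f \<in> K \<Longrightarrow> a \<in> C \<Longrightarrow> 0 \<le> f a" "f \<in> K \<Longrightarrow> a \<in> C \<Longrightarrow> f a \<le> 1"
  using character_zero_one K_character by blast+

lemma K_one: "f \<in> K \<Longrightarrow> f \<one> = 1"
  using K_character by (auto simp: character_def)

lemma K_zero: "f \<in> K \<Longrightarrow> f \<zero> = 0"
  using character_add[OF K_character zero_closed zero_closed osum_zero[OF zero_closed], of f] by simp

lemma K_sc: "f \<in> K \<Longrightarrow> 0 \<le> r \<Longrightarrow> r \<le> 1 \<Longrightarrow> f (sc r) = r"
  using character_act[OF K_character one_closed, of f r] K_one[of f] by simp

lemma K_add: "f \<in> K \<Longrightarrow> a \<in> C \<Longrightarrow> b \<in> C \<Longrightarrow> osum E a b = Some c \<Longrightarrow> f c = f a + f b"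
  using character_add K_character by blast

lemma K_mult: "f \<in> K \<Longrightarrow> a \<in> C \<Longrightarrow> b \<in> C \<Longrightarrow> f (a \<odot> b) = f a * f b"
  using K_character by (auto simp: character_def)

text \<open>A sum exists exactly when \<open>a\<close> lies below the complement of
  \<open>b\<close>, and characters determine the order.\<close>

lemma osum_exists_iff:
  assumes "a \<in> C" "b \<in> C" shows "(\<exists>c. osum E a b = Some c) \<longleftrightarrow> (\<forall>f\<in>K. f a + f b \<le> 1)"
proof -
  have "(\<exists>c. osum E a b = Some c) \<longleftrightarrow> (\<forall>f\<in>K. f a \<le> f (ecompl E b))"
    using leq_compl_iff[OF assms] leq_iff[OF assms(1) compl_closed[OF assms(2)]] by simp
  also have "\<dots> \<longleftrightarrow> (\<forall>f\<in>K. f a + f b \<le> 1)"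
  proof (rule ball_cong[OF refl])
    fix f assume "f \<in> K"
    then have "f (ecompl E b) = 1 - f b" by (rule character_compl[OF K_character assms(2)])
    then show "f a \<le> f (ecompl E b) \<longleftrightarrow> f a + f b \<le> 1" by auto
  qed
  finally show ?thesis .
qed

lemma convex_combination:
  assumes "a \<in> C" "b \<in> C" "0 \<le> r" "r \<le> 1"
  obtains c where "c \<in> C" "\<And>f. f \<in> K \<Longrightarrow> f c = r * f a + (1 - r) * f b"
proof -
  have C: "act r a \<in> C" "act (1 - r) b \<in> C" using assms by (auto intro: act_closed)
  have v: "f (act r a) = r * f a" "f (act (1 - r) b) = (1 - r) * f b" if "f \<in> K" for f
    using character_act[OF K_character[OF that]] assms by auto
  have "f (act r a) + f (act (1 - r) b) \<le> 1" if "f \<in> K" for f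
    unfolding v[OF that] using that K_zero_one assms by (intro convex_bound_le) auto
  then obtain c where c: "osum E (act r a) (act (1 - r) b) = Some c"
    using osum_exists_iff[OF C] by blast
  show thesis using that[of c] K_add[OF _ C c] osum_closed[OF C c] v by simp
qed

text \<open>The real linear span of the evaluations, each member given by a single element. The form
  \<open>2 * f a - 1\<close>, with values between -1 and 1, avoids differences: negation is
  complementation.\<close>

definition span_functions :: "(('a \<Rightarrow> real) \<Rightarrow> real) set" where
  "span_functions = {g. continuous_on K g \<and> (\<exists>t\<ge>0. \<exists>a\<in>C. \<forall>f\<in>K. g f = t * (2 * f a - 1))}"

lemma span_functions_intro:
  assumes "continuous_on K g" "t \<ge> 0" "a \<in> C" "\<And>f. f \<in> K \<Longrightarrow> g f = t * (2 * f a - 1)"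
  shows "g \<in> span_functions"
  using assms unfolding span_functions_def by blast

lemma span_functions_elim:
  assumes "g \<in> span_functions"
  obtains t a where "t \<ge> 0" "a \<in> C" "\<And>f. f \<in> K \<Longrightarrow> g f = t * (2 * f a - 1)" "continuous_on K g"
  using assms unfolding span_functions_def by blast

lemma span_functions_add:
  assumes g: "g \<in> span_functions" and h: "h \<in> span_functions"
  shows "(\<lambda>f. g f + h f) \<in> span_functions"
proof -
  obtain t a where g: "t \<ge> 0" "a \<in> C" "\<And>f. f \<in> K \<Longrightarrow> g f = t * (2 * f a - 1)" "continuous_on K g"
    using g unfolding span_functions_def by blast
  obtain s b where h: "s \<ge> 0" "b \<in> C" "\<And>f. f \<in> K \<Longrightarrow> h f = s * (2 * f b - 1)" "continuous_on K h"
    using h unfolding span_functions_def by blast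
  \<comment> \<open>For \<open>t + s = 0\<close> the quotient is 0 by convention, a harmless weight
    since both functions then vanish on \<open>K\<close>.\<close>
  have "0 \<le> t / (t + s)" "t / (t + s) \<le> 1" using g(1) h(1) by (auto simp: divide_simps)
  then obtain c where c: "c \<in> C" "\<And>f. f \<in> K \<Longrightarrow> f c = t / (t + s) * f a + (1 - t / (t + s)) * f b"
    using convex_combination[OF g(2) h(2), of "t / (t + s)"] by blast
  have "g f + h f = (t + s) * (2 * f c - 1)" if "f \<in> K" for f
  proof (cases "t + s = 0")
    case True
    then have "t = 0" "s = 0" using g(1) h(1) by linarith+
    then show ?thesis using g(3)[OF that] h(3)[OF that] by simp
  next
    case False
    then have "(t + s) * (t / (t + s)) = t" "(t + s) * (1 - t / (t + s)) = s"
      by (simp_all add: right_diff_distrib)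
    then have "(t + s) * f c = t * f a + s * f b"
      unfolding c(2)[OF that] by (simp only: semiring_class.distrib_left mult.assoc[symmetric])
    then show ?thesis using g(3)[OF that] h(3)[OF that] by (simp add: algebra_simps)
  qed
  then show ?thesis
    using g(1,4) h(1,4) c(1) by (intro span_functions_intro[of _ "t + s" c] continuous_intros) auto
qed

text \<open>With \<open>a'\<close> and \<open>b'\<close> the complements,
  \<open>(2a - 1)(2b - 1) = 2(ab + a'b') - 1\<close>; the sum on the right is defined because
  \<open>ab' + ba'\<close> is nonnegative.\<close>

lemma span_functions_mult:
  assumes g: "g \<in> span_functions" and h: "h \<in> span_functions"
  shows "(\<lambda>f. g f * h f) \<in> span_functions"
proof -
  obtain t a where g: "t \<ge> 0" "a \<in> C" "\<And>f. f \<in> K \<Longrightarrow> g f = t * (2 * f a - 1)" "continuous_on K g"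
    using g unfolding span_functions_def by blast
  obtain s b where h: "s \<ge> 0" "b \<in> C" "\<And>f. f \<in> K \<Longrightarrow> h f = s * (2 * f b - 1)" "continuous_on K h"
    using h unfolding span_functions_def by blast
  let ?a = "ecompl E a" and ?b = "ecompl E b"
  have cl: "?a \<in> C" "?b \<in> C" using g h compl_closed by auto
  have C: "a \<odot> b \<in> C" "?a \<odot> ?b \<in> C" using g h cl mult_closed by auto
  have v: "f (a \<odot> b) = f a * f b" "f (?a \<odot> ?b) = (1 - f a) * (1 - f b)" if "f \<in> K" for f
    using K_mult[OF that] g(2) h(2) cl character_compl[OF K_character[OF that]] by auto
  have "f (a \<odot> b) + f (?a \<odot> ?b) \<le> 1" if "f \<in> K" for f
  proof -
    have "0 \<le> f a * (1 - f b) + f b * (1 - f a)"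
      using K_zero_one[OF that g(2)] K_zero_one[OF that h(2)] by simp
    then show ?thesis unfolding v[OF that] by (simp add: algebra_simps)
  qed
  then obtain c where c: "osum E (a \<odot> b) (?a \<odot> ?b) = Some c"
    using osum_exists_iff[OF C] by blast
  have "g f * h f = (t * s) * (2 * f c - 1)" if "f \<in> K" for f
    unfolding g(3)[OF that] h(3)[OF that] K_add[OF that C c] v[OF that] by (simp add: algebra_simps)
  then show ?thesis
    using g(1,4) h(1,4) osum_closed[OF C c]
    by (intro span_functions_intro[of _ "t * s" c] continuous_intros) auto
qed

lemma span_functions_const: "(\<lambda>f. r) \<in> span_functions"
proof (cases "r \<ge> 0")
  case True
  then show ?thesis
    using one_closed K_one by (intro span_functions_intro[of _ r \<one>] continuous_intros) auto
next
  case False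
  show ?thesis
  proof (rule span_functions_intro[of _ "- r" \<zero>])
    fix f assume "f \<in> K"
    then show "r = - r * (2 * f \<zero> - 1)" using K_zero[of f] by simp
  qed (use False zero_closed in auto)
qed

lemma span_functions_evaluation:
  assumes "a \<in> C" shows "(\<lambda>f. f a) \<in> span_functions"
proof -
  have "(\<lambda>f. 2 * f a - 1) \<in> span_functions"
    using assms by (intro span_functions_intro[of _ 1 a] continuous_intros continuous_on_evaluation) auto
  from span_functions_add[OF span_functions_mult[OF span_functions_const[of "1/2"] this] span_functions_const[of "1/2"]]
  show ?thesis by (simp add: algebra_simps)
qed

text \<open>Double \<open>n\<close> times; the bound on the final value keeps each intermediate sum
  defined.\<close>

lemma double_power:
  assumes "c \<in> C" "\<And>f. f \<in> K \<Longrightarrow> 2 ^ n * f c \<le> 1"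
  shows "\<exists>b\<in>C. \<forall>f\<in>K. f b = 2 ^ n * f c"
  using assms
proof (induction n arbitrary: c)
  case 0 then show ?case by auto
next
  case (Suc n)
  have "f c + f c \<le> 1" if "f \<in> K" for f
  proof -
    have "1 * f c \<le> 2 ^ n * f c" using K_zero_one(1)[OF that Suc.prems(1)] by (intro mult_right_mono) auto
    then show ?thesis using Suc.prems(2)[OF that] by simp
  qed
  then obtain d where d: "osum E c c = Some d" using osum_exists_iff Suc.prems(1) by blast
  have dC: "d \<in> C" "\<And>f. f \<in> K \<Longrightarrow> f d = 2 * f c"
    using d Suc.prems(1) osum_closed[OF _ _ d] K_add[OF _ _ _ d] by auto
  have eq: "2 ^ n * f d = 2 ^ Suc n * f c" if "f \<in> K" for f using dC(2)[OF that] by simp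
  have "\<exists>b\<in>C. \<forall>f\<in>K. f b = 2 ^ n * f d"
    by (rule Suc.IH[OF dC(1)]) (use eq Suc.prems(2) in metis)
  then show ?case using eq by metis
qed

text \<open>For \<open>t > 0\<close>, nonnegativity of \<open>g\<close> means
  \<open>a \<ge> 1/2\<close>, so \<open>c = a - 1/2\<close> exists and \<open>g\<close> equals
  \<open>2t\<close> times \<open>c\<close>. The factor may exceed 1: scale by \<open>2t/2^n\<close>
  first, then double \<open>n\<close> times.\<close>

lemma span_functions_unit_interval:
  assumes g: "g \<in> span_functions" and g01: "\<And>f. f \<in> K \<Longrightarrow> 0 \<le> g f \<and> g f \<le> 1"
  shows "\<exists>b\<in>C. \<forall>f\<in>K. f b = g f"
proof -
  obtain t a where g: "t \<ge> 0" "a \<in> C" "\<And>f. f \<in> K \<Longrightarrow> g f = t * (2 * f a - 1)"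
    using g unfolding span_functions_def by blast
  show ?thesis
  proof (cases "t = 0")
    case True
    then show ?thesis using g(3) zero_closed K_zero by (intro bexI[of _ \<zero>]) simp_all
  next
    case False
    then have t: "t > 0" using g by simp
    have hC: "sc (1/2) \<in> C" by (rule sc_closed) auto
    have "f (sc (1/2)) \<le> f a" if "f \<in> K" for f
    proof -
      have "0 \<le> 2 * f a - 1" using g01[OF that] g(3)[OF that] t by (simp add: zero_le_mult_iff)
      then show ?thesis using K_sc[OF that, of "1/2"] by simp
    qed
    then have "sc (1/2) \<sqsubseteq> a" using leq_iff[OF hC g(2)] by blast
    then obtain c where c: "c \<in> C" "osum E (sc (1/2)) c = Some a" unfolding ele_def by blast
    have fc: "f c = f a - 1/2" if "f \<in> K" for f
      using K_add[OF that hC c] K_sc[OF that, of "1/2"] by simp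
    obtain n where "2 * t < 2 ^ n" using real_arch_pow[of 2 "2 * t"] by auto
    then have n: "0 \<le> 2 * t / 2 ^ n" "2 * t / 2 ^ n \<le> 1" using t by simp_all
    have eq: "2 ^ n * f (act (2 * t / 2 ^ n) c) = g f" if "f \<in> K" for f
      unfolding character_act[OF K_character[OF that] c(1) n] g(3)[OF that] fc[OF that]
      by (simp add: field_simps)
    have "act (2 * t / 2 ^ n) c \<in> C" by (rule act_closed[OF n c(1)])
    from double_power[OF this, of n] show ?thesis using g01 eq by auto
  qed
qed

lemma approximation:
  assumes G: "continuous_on K G" and G01: "\<And>f. f \<in> K \<Longrightarrow> 0 \<le> G f \<and> G f \<le> 1" and e: "e > 0"
  shows "\<exists>a\<in>C. \<forall>f\<in>K. \<bar>f a - G f\<bar> \<le> e"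
proof -
  interpret function_ring_on span_functions K
  proof
    show "compact K" by (rule compact_character_space)
    show "continuous_on K g" if "g \<in> span_functions" for g using that span_functions_elim by blast
    show "\<exists>g\<in>span_functions. g x \<noteq> g y" if "x \<in> K" "y \<in> K" "x \<noteq> y" for x y
    proof -
      have "\<exists>a\<in>C. x a \<noteq> y a"
      proof (rule ccontr)
        assume "\<not> (\<exists>a\<in>C. x a \<noteq> y a)"
        moreover have "x \<in> extensional C" "y \<in> extensional C"
          using that by (auto simp: character_space_def character_def PiE_def)
        ultimately have "x = y" by (intro extensionalityI) auto
        then show False using that by simp
      qed
      then show ?thesis using span_functions_evaluation by (metis (no_types, lifting))
    qed
  qed (simp_all add: span_functions_add span_functions_mult span_functions_const)
  define d where "d = e / 2"
  have d: "d > 0" using e by (simp add: d_def)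
  obtain g where g: "g \<in> span_functions" "\<And>f. f \<in> K \<Longrightarrow> \<bar>G f - g f\<bar> < d"
    using Stone_Weierstrass_basic[OF G d] by blast
  \<comment> \<open>The Stone-Weierstrass approximant may leave the unit interval by
    \<open>d\<close> on either side; this affine map brings it back. Approximation and squeezing
    cost at most \<open>d\<close> each, hence \<open>d = e / 2\<close>.\<close>
  have "(\<lambda>f. 1 / (1 + 2 * d) * (g f + d)) \<in> span_functions"
    by (intro span_functions_mult span_functions_add span_functions_const g)
  moreover have "0 \<le> 1 / (1 + 2 * d) * (g f + d) \<and> 1 / (1 + 2 * d) * (g f + d) \<le> 1" if "f \<in> K" for f
    using g(2)[OF that] G01[OF that] d by (auto simp: field_simps)
  ultimately obtain a where a: "a \<in> C" "\<forall>f\<in>K. f a = 1 / (1 + 2 * d) * (g f + d)"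
    using span_functions_unit_interval[of "\<lambda>f. 1 / (1 + 2 * d) * (g f + d)"] by blast
  have "\<bar>f a - G f\<bar> \<le> e" if "f \<in> K" for f
  proof -
    have *: "(1 + 2 * d) * (f a - G f) = (g f - G f) + d * (1 - 2 * G f)"
      using a that d by (simp add: field_simps)
    have "\<bar>d * (1 - 2 * G f)\<bar> \<le> d * 1"
      unfolding abs_mult using d G01[OF that] by (intro mult_mono) auto
    then have "\<bar>(1 + 2 * d) * (f a - G f)\<bar> \<le> 2 * d" using * g(2)[OF that] by simp
    moreover have "1 * \<bar>f a - G f\<bar> \<le> (1 + 2 * d) * \<bar>f a - G f\<bar>"
      using d by (intro mult_right_mono) auto
    ultimately show ?thesis using d by (simp add: abs_mult d_def)
  qed
  then show ?thesis using a by blast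
qed

text \<open>Values between 1/4 and 3/4 leave room to approximate by increasing sequences.\<close>

lemma representable_middle:
  assumes G: "continuous_on K G" and G01: "\<And>f. f \<in> K \<Longrightarrow> 1/4 \<le> G f \<and> G f \<le> 3/4"
  obtains b where "b \<in> C" "\<And>f. f \<in> K \<Longrightarrow> f b = G f"
proof -
  \<comment> \<open>Starting at 1/16 keeps \<open>G - 3 * eps n\<close> and \<open>G + eps n\<close>
    in the unit interval, as \<open>G\<close> stays between 1/4 and 3/4.\<close>
  define eps :: "nat \<Rightarrow> real" where "eps n = 1 / 2 ^ (n + 4)" for n
  have eps: "0 < eps n" "eps n \<le> 1/16" "eps (Suc n) = eps n / 2" for n
    unfolding eps_def by (auto simp: power_add)
  \<comment> \<open>The value of the chosen \<open>a n\<close> lies between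
    \<open>G - 4 * eps n\<close> and \<open>G - 2 * eps n\<close>. As \<open>eps\<close> halves,
    consecutive ranges just touch, which makes the sequence increasing.\<close>
  have "\<exists>a\<in>C. \<forall>f\<in>K. \<bar>f a - (G f - 3 * eps n)\<bar> \<le> eps n" for n
  proof -
    have "0 \<le> G f - 3 * eps n \<and> G f - 3 * eps n \<le> 1" if "f \<in> K" for f
      using G01[OF that] eps(1,2)[of n] by simp
    then show ?thesis by (intro approximation continuous_intros G eps)
  qed
  then obtain a where a: "\<And>n. a n \<in> C" "\<And>f n. f \<in> K \<Longrightarrow> \<bar>f (a n) - (G f - 3 * eps n)\<bar> \<le> eps n"
    by metis
  have "a n \<sqsubseteq> a (Suc n)" for n
    unfolding leq_iff[OF a(1) a(1)]
  proof
    fix f assume "f \<in> K"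
    then show "f (a n) \<le> f (a (Suc n))" using a(2)[of f n] a(2)[of f "Suc n"] eps(3)[of n] by argo
  qed
  then obtain b where b: "is_esup E (range a) b" using omega a(1) unfolding omega_complete_def by blast
  then have bC: "b \<in> C" by (simp add: is_esup_def)
  have lim: "eps \<longlonglongrightarrow> 0" unfolding eps_def by real_asymp
  have ge: "G f \<le> f b" if f: "f \<in> K" for f
  proof -
    have "G f - 4 * eps n \<le> f b" for n
    proof -
      have "a n \<sqsubseteq> b" using b by (auto simp: is_esup_def)
      then have "f (a n) \<le> f b" using leq_iff[OF a(1) bC] f by blast
      then show ?thesis using a(2)[OF f, of n] by simp
    qed
    moreover have "(\<lambda>n. G f - 4 * eps n) \<longlonglongrightarrow> G f - 4 * 0" by (intro tendsto_intros lim)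
    ultimately show ?thesis by (intro LIMSEQ_le_const2) auto
  qed
  \<comment> \<open>The supremum is order-theoretic and need not be pointwise a priori. Elements
    \<open>u\<close> with values between \<open>G\<close> and \<open>G + 2 * eps n\<close> bound all
    \<open>a m\<close>, hence bound \<open>b\<close>.\<close>
  have le: "f b \<le> G f" if f: "f \<in> K" for f
  proof -
    have "f b \<le> G f + 2 * eps n" for n
    proof -
      have "0 \<le> G f + eps n \<and> G f + eps n \<le> 1" if "f \<in> K" for f
        using G01[OF that] eps(1,2)[of n] by simp
      then have "\<exists>u\<in>C. \<forall>f\<in>K. \<bar>f u - (G f + eps n)\<bar> \<le> eps n"
        by (intro approximation continuous_intros G eps)
      then obtain u where u: "u \<in> C" "\<And>f. f \<in> K \<Longrightarrow> \<bar>f u - (G f + eps n)\<bar> \<le> eps n" by blast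
      have "a m \<sqsubseteq> u" for m
        unfolding leq_iff[OF a(1) u(1)]
      proof
        fix f assume "f \<in> K"
        then show "f (a m) \<le> f u" using a(2)[of f m] u(2)[of f] eps(1)[of m] by simp
      qed
      then have "b \<sqsubseteq> u" using b u by (auto simp: is_esup_def)
      then have "f b \<le> f u" using leq_iff[OF bC u(1)] f by blast
      then show ?thesis using u(2)[OF f] by simp
    qed
    moreover have "(\<lambda>n. G f + 2 * eps n) \<longlonglongrightarrow> G f + 2 * 0" by (intro tendsto_intros lim)
    ultimately show ?thesis by (intro LIMSEQ_le_const) auto
  qed
  show thesis using that[OF bC] ge le by (meson antisym)
qed

text \<open>Compress \<open>G\<close> into the interval from 1/4 to 3/4, represent it there, and
  undo the affine map inside the span.\<close>

lemma representable:
  assumes G: "continuous_on K G" and G01: "\<And>f. f \<in> K \<Longrightarrow> 0 \<le> G f \<and> G f \<le> 1"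
  shows "\<exists>b\<in>C. \<forall>f\<in>K. f b = G f"
proof -
  obtain b where b: "b \<in> C" "\<And>f. f \<in> K \<Longrightarrow> f b = 1/4 + 1/2 * G f"
    by (rule representable_middle[of "\<lambda>f. 1/4 + 1/2 * G f"])
      (use G G01 in \<open>auto intro!: continuous_intros\<close>)
  have "(\<lambda>f. 2 * f b + (-1/2)) \<in> span_functions"
    by (intro span_functions_mult span_functions_add span_functions_const span_functions_evaluation b)
  note span = this
  have eq: "2 * f b + (-1/2) = G f" if "f \<in> K" for f using b(2)[OF that] by simp
  have "\<exists>b'\<in>C. \<forall>f\<in>K. f b' = 2 * f b + (-1/2)"
    by (rule span_functions_unit_interval[OF span]) (use eq G01 in metis)
  then show ?thesis using eq by metis
qed

end

section \<open>Suprema and disconnectedness\<close>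

lemma unit_interval_C_simps [simp]:
  "ecarrier (unit_interval_C X) = {f \<in> extensional (topspace X). continuous_map X (top_of_set {0..1}) f}"
  "osum (unit_interval_C X) f g = (if \<forall>x\<in>topspace X. f x + g x \<le> 1
     then Some (\<lambda>x\<in>topspace X. f x + g x) else None)"
  "emult (unit_interval_C X) f g = (\<lambda>x\<in>topspace X. f x * g x)"
  "eone (unit_interval_C X) = (\<lambda>x\<in>topspace X. 1)"
  by (auto simp: unit_interval_C_def eone_def fun_eq_iff)

lemma unit_interval_C_carrier:
  "f \<in> ecarrier (unit_interval_C X) \<longleftrightarrow> f \<in> extensional (topspace X) \<and>
     continuous_map X euclideanreal f \<and> (\<forall>x\<in>topspace X. 0 \<le> f x \<and> f x \<le> 1)"
  by (auto simp: continuous_map_in_subtopology image_subset_iff)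

lemma restrict_in_unit_interval_C:
  assumes "continuous_map X euclideanreal f" "\<And>x. x \<in> topspace X \<Longrightarrow> 0 \<le> f x \<and> f x \<le> 1"
  shows "restrict f (topspace X) \<in> ecarrier (unit_interval_C X)"
proof -
  have "continuous_map X euclideanreal (restrict f (topspace X))"
    by (rule continuous_map_eq[OF assms(1)]) simp
  then show ?thesis using assms(2) unfolding unit_interval_C_carrier by simp
qed

lemma ele_unit_interval_C:
  assumes f: "f \<in> ecarrier (unit_interval_C X)" and g: "g \<in> ecarrier (unit_interval_C X)"
  shows "ele (unit_interval_C X) f g \<longleftrightarrow> (\<forall>x\<in>topspace X. f x \<le> g x)"
proof
  assume "ele (unit_interval_C X) f g"
  then obtain h where "h \<in> ecarrier (unit_interval_C X)" "osum (unit_interval_C X) f h = Some g"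
    unfolding ele_def by blast
  then show "\<forall>x\<in>topspace X. f x \<le> g x"
    unfolding unit_interval_C_carrier by (auto split: if_splits)
next
  assume le: "\<forall>x\<in>topspace X. f x \<le> g x"
  let ?h = "restrict (\<lambda>x. g x - f x) (topspace X)"
  have "?h \<in> ecarrier (unit_interval_C X)"
    by (rule restrict_in_unit_interval_C)
      (use f g le in \<open>unfold unit_interval_C_carrier, auto intro: continuous_map_diff simp: diff_le_eq add_increasing2\<close>)
  moreover have "restrict (\<lambda>x. f x + ?h x) (topspace X) = g"
    using g unfolding unit_interval_C_carrier by (auto simp: fun_eq_iff extensional_def)
  then have "osum (unit_interval_C X) f ?h = Some g"
    using g unfolding unit_interval_C_carrier by simp
  ultimately show "ele (unit_interval_C X) f g" unfolding ele_def by blast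
qed

text \<open>Continuity makes \<open>s\<close> equal to 1 on the closure of \<open>U\<close>, and
  Urysohn functions force it to be 0 elsewhere.\<close>

lemma closure_open_if_esup:
  assumes X: "normal_space X" "Hausdorff_space X" and U: "openin X U"
    and s: "is_esup (unit_interval_C X) A s"
    and A: "A \<subseteq> ecarrier (unit_interval_C X)"
    and A0: "\<And>f x. f \<in> A \<Longrightarrow> x \<in> topspace X - U \<Longrightarrow> f x = 0"
    and A1: "\<And>x. x \<in> U \<Longrightarrow> \<exists>f\<in>A. f x = 1"
  shows "openin X (X closure_of U)"
proof -
  have sF: "s \<in> ecarrier (unit_interval_C X)" using s by (simp add: is_esup_def)
  have cont: "continuous_map X euclideanreal s" and s01: "\<And>x. x \<in> topspace X \<Longrightarrow> 0 \<le> s x \<and> s x \<le> 1"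
    using sF unfolding unit_interval_C_carrier by auto
  have UX: "U \<subseteq> topspace X" using U openin_subset by blast
  have upper: "f x \<le> s x" if "f \<in> A" "x \<in> topspace X" for f x
    using s that A ele_unit_interval_C[OF _ sF] unfolding is_esup_def by blast
  have s1: "s x = 1" if "x \<in> U" for x
    using A1[OF that] upper s01 UX that by (metis antisym subsetD)
  have "closedin X {x \<in> topspace X. s x \<in> {1}}"
    by (rule closedin_continuous_map_preimage[OF cont]) simp
  then have cl1: "X closure_of U \<subseteq> {x \<in> topspace X. s x \<in> {1}}"
    by (rule closure_of_minimal[rotated]) (use s1 UX in auto)
  have s0: "s x = 0" if x: "x \<in> topspace X - X closure_of U" for x
  proof -
    have "closedin X {x}" using X x by (simp add: closedin_Hausdorff_sing_eq)
    \<comment> \<open>This \<open>g\<close> is 0 at \<open>x\<close> and 1 on the closure, so it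
      bounds \<open>A\<close> from above and hence bounds \<open>s\<close>.\<close>
    then obtain g where g: "continuous_map X (top_of_set {0..1::real}) g" "g ` {x} \<subseteq> {0}" "g ` (X closure_of U) \<subseteq> {1}"
      using Urysohn_lemma[OF X(1), of "{x}" "X closure_of U" 0 1] x by (auto simp: disjnt_def)
    let ?g = "restrict g (topspace X)"
    have gF: "?g \<in> ecarrier (unit_interval_C X)"
      using g(1) by (intro restrict_in_unit_interval_C) (auto simp: continuous_map_in_subtopology image_subset_iff)
    have "ele (unit_interval_C X) f ?g" if "f \<in> A" for f
    proof -
      have f: "f \<in> ecarrier (unit_interval_C X)" using A that by blast
      have "f y \<le> g y" if y: "y \<in> topspace X" for y
      proof (cases "y \<in> U")
        case True
        then have "g y = 1" using g(3) closure_of_subset[OF UX] by blast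
        then show ?thesis using f y unfolding unit_interval_C_carrier by auto
      next
        case False
        then show ?thesis using A0[OF \<open>f \<in> A\<close>] y gF unfolding unit_interval_C_carrier by auto
      qed
      then show ?thesis using ele_unit_interval_C[OF f gF] by simp
    qed
    then have "ele (unit_interval_C X) s ?g" using s gF unfolding is_esup_def by blast
    then have "s x \<le> ?g x" using ele_unit_interval_C[OF sF gF] x by blast
    then show ?thesis using g(2) x s01[of x] by auto
  qed
  have "X closure_of U = {x \<in> topspace X. s x \<in> {1/2<..}}"
    using cl1 s0 closure_of_subset_topspace[of X U] by force
  moreover have "openin X {x \<in> topspace X. s x \<in> {1/2<..}}"
    by (rule openin_continuous_map_preimage[OF cont]) simp
  ultimately show ?thesis by simp
qed

lemma basically_disconnected_if_omega_complete:
  assumes X: "normal_space X" "Hausdorff_space X" and omega: "omega_complete (unit_interval_C X)"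
  shows "basically_disconnected X"
  unfolding basically_disconnected_def
proof (intro allI impI)
  fix U assume "cozero_set_in X U"
  then obtain f where f: "continuous_map X euclideanreal f" "U = {x \<in> topspace X. f x \<noteq> 0}"
    by (auto simp: cozero_set_in_def)
  \<comment> \<open>An increasing sequence vanishing off \<open>U\<close>; truncation at 1 makes it
    attain the value 1 at each point of \<open>U\<close> from some index on.\<close>
  define a where "a n = restrict (\<lambda>x. min 1 (real n * \<bar>f x\<bar>)) (topspace X)" for n
  have aF: "a n \<in> ecarrier (unit_interval_C X)" for n
    unfolding a_def
    by (rule restrict_in_unit_interval_C) (auto intro!: continuous_intros f continuous_map_real_min)
  have "ele (unit_interval_C X) (a n) (a (Suc n))" for n
    unfolding ele_unit_interval_C[OF aF aF]
  proof
    fix x assume "x \<in> topspace X"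
    moreover have "real n * \<bar>f x\<bar> \<le> real (Suc n) * \<bar>f x\<bar>" by (rule mult_right_mono) auto
    ultimately show "a n x \<le> a (Suc n) x" unfolding a_def by (simp only: restrict_apply' min.mono order_refl)
  qed
  then obtain s where s: "is_esup (unit_interval_C X) (range a) s"
    using omega aF unfolding omega_complete_def by blast
  have U: "U = {x \<in> topspace X. f x \<in> - {0}}" using f by auto
  have "openin X U" unfolding U by (rule openin_continuous_map_preimage[OF f(1)]) auto
  then show "openin X (X closure_of U)"
  proof (rule closure_open_if_esup[OF X _ s])
    show "range a \<subseteq> ecarrier (unit_interval_C X)" using aF by blast
    show "g x = 0" if "g \<in> range a" "x \<in> topspace X - U" for g x
      using that f by (auto simp: a_def)
    show "\<exists>g\<in>range a. g x = 1" if "x \<in> U" for x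
    proof -
      have x: "x \<in> topspace X" "\<bar>f x\<bar> > 0" using that f by auto
      then obtain n where "1 < real n * \<bar>f x\<bar>" using reals_Archimedean3 by blast
      then show ?thesis using x by (intro bexI[of _ "a n"]) (auto simp: a_def)
    qed
  qed
qed

lemma extremally_disconnected_if_directed_complete:
  assumes X: "normal_space X" "Hausdorff_space X" and dir: "directed_complete (unit_interval_C X)"
  shows "extremally_disconnected X"
  unfolding extremally_disconnected_def
proof (intro allI impI)
  fix U assume U: "openin X U"
  let ?F = "ecarrier (unit_interval_C X)"
  \<comment> \<open>All functions vanishing off \<open>U\<close>: pointwise maxima make the family
    directed, and Urysohn functions attain 1 at any given point of \<open>U\<close>.\<close>
  define A where "A = {f \<in> ?F. \<forall>x\<in>topspace X - U. f x = 0}"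
  have "restrict (\<lambda>x. 0) (topspace X) \<in> ?F" by (rule restrict_in_unit_interval_C) auto
  then have "restrict (\<lambda>x. 0) (topspace X) \<in> A" by (simp add: A_def)
  moreover have "\<exists>h\<in>A. ele (unit_interval_C X) f h \<and> ele (unit_interval_C X) g h" if "f \<in> A" "g \<in> A" for f g
  proof -
    let ?h = "restrict (\<lambda>x. max (f x) (g x)) (topspace X)"
    have fg: "f \<in> ?F" "g \<in> ?F" using that by (auto simp: A_def)
    have h: "?h \<in> ?F"
      by (rule restrict_in_unit_interval_C)
        (use fg in \<open>unfold unit_interval_C_carrier, auto intro: continuous_map_real_max simp: le_max_iff_disj\<close>)
    have "?h \<in> A" using h that by (simp add: A_def)
    then show ?thesis
      using ele_unit_interval_C[OF fg(1) h] ele_unit_interval_C[OF fg(2) h] by (intro bexI[of _ ?h]) auto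
  qed
  moreover have "A \<subseteq> ?F" by (auto simp: A_def)
  ultimately have "directed_in (unit_interval_C X) A"
    unfolding directed_in_def by blast
  then obtain s where s: "is_esup (unit_interval_C X) A s"
    using dir unfolding directed_complete_def by blast
  show "openin X (X closure_of U)"
  proof (rule closure_open_if_esup[OF X U s])
    show "\<exists>g\<in>A. g x = 1" if xU: "x \<in> U" for x
    proof -
      have x: "x \<in> topspace X" using xU U openin_subset by blast
      then have "closedin X {x}" using X by (simp add: closedin_Hausdorff_sing_eq)
      moreover have "closedin X (topspace X - U)" using U by blast
      ultimately obtain g where g: "continuous_map X (top_of_set {0..1::real}) g"
        "g ` (topspace X - U) \<subseteq> {0}" "g ` {x} \<subseteq> {1}"
        using Urysohn_lemma[OF X(1), of "topspace X - U" "{x}" 0 1] xU by (auto simp: disjnt_def)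
      have "restrict g (topspace X) \<in> ?F"
        using g(1) by (intro restrict_in_unit_interval_C) (auto simp: continuous_map_in_subtopology image_subset_iff)
      then have "restrict g (topspace X) \<in> A" using g(2) by (auto simp: A_def)
      then show ?thesis using g(3) x by (intro bexI) auto
    qed
  qed (auto simp: A_def)
qed

section \<open>Transport of completeness along isomorphisms\<close>

lemma hom_ele:
  assumes "effect_monoid_hom E F h" "a \<in> ecarrier E" "ele E a b"
  shows "ele F (h a) (h b)"
  using assms unfolding effect_monoid_hom_def ele_def by fast

lemma isomorphic_esup:
  assumes h: "bij_betw h (ecarrier E) (ecarrier F)" and hom: "effect_monoid_hom E F h"
    and inv: "effect_monoid_hom F E k" and k: "k = inv_into (ecarrier E) h"
    and A: "A \<subseteq> ecarrier F" and s: "is_esup E (k ` A) s"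
  shows "is_esup F A (h s)"
proof -
  have hk: "h (k x) = x" "k x \<in> ecarrier E" if "x \<in> ecarrier F" for x
    using bij_betw_inv_into_right[OF h] that bij_betwE[OF bij_betw_inv_into[OF h]] k by auto
  have kh: "k (h x) = x" "h x \<in> ecarrier F" if "x \<in> ecarrier E" for x
    using bij_betw_inv_into_left[OF h] that bij_betwE[OF h] k by auto
  have sC: "s \<in> ecarrier E" using s by (simp add: is_esup_def)
  show ?thesis unfolding is_esup_def
  proof (intro conjI ballI impI)
    show "h s \<in> ecarrier F" using kh sC by blast
    fix a assume a: "a \<in> A"
    have "ele E (k a) s" using s a by (auto simp: is_esup_def)
    then show "ele F a (h s)" using hom_ele[OF hom, of "k a" s] hk[of a] A a by auto
  next
    fix u assume u: "u \<in> ecarrier F" and ub: "\<forall>a\<in>A. ele F a u"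
    have "\<forall>a\<in>k ` A. ele E a (k u)" using hom_ele[OF inv] ub A by blast
    then have "ele E s (k u)" using s hk[OF u] unfolding is_esup_def by blast
    then show "ele F (h s) u" using hom_ele[OF hom sC, of "k u"] hk[OF u] by simp
  qed
qed

lemma isomorphic_omega_complete:
  assumes "effect_monoid_isomorphic E F" "omega_complete E"
  shows "omega_complete F"
proof -
  obtain h where h: "bij_betw h (ecarrier E) (ecarrier F)" "effect_monoid_hom E F h"
    "effect_monoid_hom F E (inv_into (ecarrier E) h)"
    using assms unfolding effect_monoid_isomorphic_def by blast
  let ?k = "inv_into (ecarrier E) h"
  show ?thesis unfolding omega_complete_def
  proof (intro allI impI, elim conjE)
    fix a :: "nat \<Rightarrow> 'c" assume a: "\<forall>n. a n \<in> ecarrier F" "\<forall>n. ele F (a n) (a (Suc n))"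
    have "\<forall>n. ?k (a n) \<in> ecarrier E" using a bij_betwE[OF bij_betw_inv_into[OF h(1)]] by blast
    moreover have "\<forall>n. ele E (?k (a n)) (?k (a (Suc n)))" using hom_ele[OF h(3)] a by blast
    ultimately obtain s where "is_esup E (range (\<lambda>n. ?k (a n))) s"
      using assms(2)[unfolded omega_complete_def, rule_format, of "\<lambda>n. ?k (a n)"] by blast
    then have "is_esup E (?k ` range a) s" by (simp add: image_image)
    from isomorphic_esup[OF h refl _ this] a show "\<exists>s. is_esup F (range a) s" by blast
  qed
qed

lemma isomorphic_directed_complete:
  assumes "effect_monoid_isomorphic E F" "directed_complete E"
  shows "directed_complete F"
proof -
  obtain h where h: "bij_betw h (ecarrier E) (ecarrier F)" "effect_monoid_hom E F h"
    "effect_monoid_hom F E (inv_into (ecarrier E) h)"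
    using assms unfolding effect_monoid_isomorphic_def by blast
  let ?k = "inv_into (ecarrier E) h"
  show ?thesis unfolding directed_complete_def
  proof (intro allI impI)
    fix A assume A: "directed_in F A"
    have "?k ` A \<subseteq> ecarrier E"
      using A bij_betwE[OF bij_betw_inv_into[OF h(1)]] unfolding directed_in_def by blast
    moreover have "\<exists>c\<in>?k ` A. ele E a c \<and> ele E b c" if "a \<in> ?k ` A" "b \<in> ?k ` A" for a b
      using that A hom_ele[OF h(3)] unfolding directed_in_def by blast
    ultimately have "directed_in E (?k ` A)" using A unfolding directed_in_def by simp
    then obtain s where "is_esup E (?k ` A) s" using assms(2) unfolding directed_complete_def by blast
    from isomorphic_esup[OF h refl _ this] A show "\<exists>s. is_esup F A s" unfolding directed_in_def by blast
  qed
qed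

section \<open>The Gelfand map is an isomorphism\<close>

context omega_complete_convex_effect_monoid
begin

definition gelfand :: "'a \<Rightarrow> ('a \<Rightarrow> real) \<Rightarrow> real" where
  "gelfand a = (\<lambda>f\<in>K. f a)"

lemma gelfand_bij: "bij_betw gelfand C (ecarrier (unit_interval_C (top_of_set K)))"
  unfolding bij_betw_def
proof
  show "inj_on gelfand C"
  proof (rule inj_onI)
    fix a b assume ab: "a \<in> C" "b \<in> C" and eq: "gelfand a = gelfand b"
    have "f a = f b" if "f \<in> K" for f using fun_cong[OF eq, of f] that by (simp add: gelfand_def)
    then have "a \<sqsubseteq> b" "b \<sqsubseteq> a" using leq_iff[OF ab] leq_iff[OF ab(2,1)] by (metis order_refl)+
    then show "a = b" using leq_antisym ab by blast
  qed
  show "gelfand ` C = ecarrier (unit_interval_C (top_of_set K))"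
  proof (intro equalityI subsetI)
    fix g assume "g \<in> gelfand ` C"
    then obtain a where a: "a \<in> C" "g = restrict (\<lambda>f. f a) (topspace (top_of_set K))"
      by (auto simp: gelfand_def)
    show "g \<in> ecarrier (unit_interval_C (top_of_set K))"
      unfolding a(2) using a(1) K_zero_one continuous_on_evaluation[of K a]
      by (intro restrict_in_unit_interval_C) simp_all
  next
    fix g assume "g \<in> ecarrier (unit_interval_C (top_of_set K))"
    then have g: "g \<in> extensional K" "continuous_on K g" "\<And>f. f \<in> K \<Longrightarrow> 0 \<le> g f \<and> g f \<le> 1"
      unfolding unit_interval_C_carrier by auto
    obtain b where b: "b \<in> C" "\<forall>f\<in>K. f b = g f" using representable[OF g(2,3)] by blast
    have "gelfand b = g"
      using b g(1) by (intro extensionalityI[of _ K]) (auto simp: gelfand_def)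
    then show "g \<in> gelfand ` C" using b by blast
  qed
qed

lemma gelfand_isomorphism: "effect_monoid_isomorphic E (unit_interval_C (top_of_set K))"
proof -
  let ?F = "unit_interval_C (top_of_set K)" and ?k = "inv_into C gelfand"
  have mem: "gelfand a \<in> ecarrier ?F" if "a \<in> C" for a using bij_betwE[OF gelfand_bij] that by blast
  have kg: "?k (gelfand a) = a" if "a \<in> C" for a using bij_betw_inv_into_left[OF gelfand_bij that] .
  have one: "gelfand \<one> = eone ?F"
    using K_one by (auto simp: gelfand_def fun_eq_iff)
  have mult: "gelfand (a \<odot> b) = emult ?F (gelfand a) (gelfand b)" if "a \<in> C" "b \<in> C" for a b
    using K_mult that by (auto simp: gelfand_def fun_eq_iff)
  have sum: "osum ?F (gelfand a) (gelfand b) = Some (gelfand c)"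
    if ab: "a \<in> C" "b \<in> C" and c: "osum E a b = Some c" for a b c
  proof -
    have le: "\<forall>f\<in>K. f a + f b \<le> 1" using osum_exists_iff[OF ab] c by blast
    have "(\<lambda>f\<in>K. f a + f b) = gelfand c"
      unfolding gelfand_def by (rule restrict_ext) (use K_add[OF _ ab c] in metis)
    moreover have "(\<lambda>f\<in>K. gelfand a f + gelfand b f) = (\<lambda>f\<in>K. f a + f b)"
      unfolding gelfand_def by (rule restrict_ext) simp
    ultimately show ?thesis using le by (simp add: gelfand_def)
  qed
  have "effect_monoid_hom E ?F gelfand"
    unfolding effect_monoid_hom_def using mem one sum mult by blast
  moreover have "effect_monoid_hom ?F E ?k"
    unfolding effect_monoid_hom_def
  proof (intro conjI ballI allI impI)
    show "?k \<in> ecarrier ?F \<rightarrow> C" using bij_betwE[OF bij_betw_inv_into[OF gelfand_bij]] by blast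
    show "?k (eone ?F) = \<one>" using kg[OF one_closed] one by simp
    fix u v assume u: "u \<in> ecarrier ?F" and v: "v \<in> ecarrier ?F"
    obtain a where a: "a \<in> C" "u = gelfand a" using gelfand_bij u unfolding bij_betw_def by blast
    obtain b where b: "b \<in> C" "v = gelfand b" using gelfand_bij v unfolding bij_betw_def by blast
    show "?k (emult ?F u v) = ?k u \<odot> ?k v"
      unfolding a b mult[OF a(1) b(1), symmetric] using kg a b mult_closed by simp
    \<comment> \<open>Here definedness must be reflected: if the functions sum to at most 1 at every
      character, the elements are summable in \<open>E\<close>.\<close>
    fix w assume w: "osum ?F u v = Some w"
    then have "\<forall>f\<in>K. f a + f b \<le> 1" unfolding a b by (auto simp: gelfand_def split: if_splits)
    then obtain c where c: "osum E a b = Some c" using osum_exists_iff[OF a(1) b(1)] by blast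
    have "w = gelfand c" using w sum[OF a(1) b(1) c] unfolding a b by simp
    then show "osum E (?k u) (?k v) = Some (?k w)"
      unfolding a b using kg a b c osum_closed by metis
  qed
  ultimately show ?thesis unfolding effect_monoid_isomorphic_def using gelfand_bij by blast
qed

end

theorem theorem66:
  fixes M :: "'a effect_monoid"
  assumes "effect_monoid M"
    and "convex_effect_algebra M"
    and "omega_complete M"
  shows "\<exists>X :: ('a \<Rightarrow> real) topology.
           compact_space X \<and> Hausdorff_space X \<and> basically_disconnected X \<and>
           effect_monoid_isomorphic M (unit_interval_C X) \<and>
           (directed_complete M \<longrightarrow> extremally_disconnected X)"
proof -
  obtain act where "convex_action M act" using assms(2) unfolding convex_effect_algebra_def by blast
  then interpret omega_complete_convex_effect_monoid M act
    using assms by (simp add: omega_complete_convex_effect_monoid_def convex_effect_monoid_def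
      omega_complete_convex_effect_monoid_axioms_def convex_effect_monoid_axioms_def)
  \<comment> \<open>Characters with pointwise convergence. If 1 = 0 in \<open>M\<close>, there are
    no characters and the space is empty.\<close>
  let ?X = "top_of_set K"
  have comp: "compact_space ?X" using compact_character_space[of M] by (simp add: compact_space_subtopology)
  have haus: "Hausdorff_space ?X" by (rule Hausdorff_space_top_of_set)
  have norm: "normal_space ?X" using compact_Hausdorff_or_regular_imp_normal_space comp haus by blast
  have "basically_disconnected ?X"
    by (rule basically_disconnected_if_omega_complete[OF norm haus
        isomorphic_omega_complete[OF gelfand_isomorphism omega]])
  moreover have "extremally_disconnected ?X" if "directed_complete M"
    by (rule extremally_disconnected_if_directed_complete[OF norm haus
        isomorphic_directed_complete[OF gelfand_isomorphism that]])
  ultimately show ?thesis using comp haus gelfand_isomorphism by blast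
qed

end
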